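(* Let $Q$ be a Markov kernel on a measurable space $(\mathsf Z,\mathcal Z)$ that satisfies the uniform geometric ergodicity assumption (UGE) with invariant distribution $\pi$ and mixing time $\tau$. Let $C_1=60e$, $C_2=60$, $D_1=\tfrac{16}{3}\left(\tfrac{19}{3}\right)^{1/2}C_1$, $D_2=\tfrac{32}{3}\left(C_2^{1/2}C_1^2+C_2\right)$, and $\widetilde{\ln}(s)=\ln(s)\log_2(2\ln s)$. Let $f:\mathsf Z\to\mathbb R$ be bounded and measurable and let $n\ge1$ be an integer. For every $\delta\in(0,1/e^2)$, with $\mathrm P_\pi$-probability at least $1-\delta$, $$|S_n|\le C_1\sqrt{2n\ln(1/\delta)}\,\sigma_\pi(f)+2D_1\,n^{1/4}\tau^{3/4}\,\|f\|_\infty\,\widetilde{\ln}(1/\delta)+2D_2\,\tau\,\|f\|_\infty\,\widetilde{\ln}(1/\delta).$$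
   Context: $(Z_k)_{k\ge0}$ is the (canonical) Markov chain with kernel $Q$; $\mathrm P_\pi$ denotes its law when $Z_0\sim\pi$. For a signed measure $\mu$, $\|\mu\|_{\mathrm{TV}}=|\mu|(\mathsf Z)$. Assumption (UGE): $Q$ has a unique invariant distribution $\pi$, and there is an integer $\tau\ge1$ such that for all integers $n\ge 0$ and all $z\in\mathsf Z$, $\tfrac12\|Q^n(z,\cdot)-\pi\|_{\mathrm{TV}}\le (1/4)^{\lfloor n/\tau\rfloor}$. For $f$ bounded measurable: $\bar f=f-\pi(f)$, $\|f\|_\infty=\sup_z|f(z)|$, $S_n=\sum_{\ell=0}^{n-1}\{f(Z_\ell)-\pi(f)\}$, and $\sigma_\pi^2(f)=\pi(\bar f^2)+2\sum_{\ell=1}^\infty\pi(\bar f\,Q^\ell\bar f)$. *)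

theory Defs
  imports "HOL-Probability.Probability"
begin

primrec kernel_pow :: "'a measure \<Rightarrow> ('a \<Rightarrow> 'a measure) \<Rightarrow> nat \<Rightarrow> 'a \<Rightarrow> 'a measure" where
  "kernel_pow M Q 0 z = return M z"
| "kernel_pow M Q (Suc n) z = kernel_pow M Q n z \<bind> Q"

definition kernel_act ::
  "'a measure \<Rightarrow> ('a \<Rightarrow> 'a measure) \<Rightarrow> nat \<Rightarrow> ('a \<Rightarrow> real) \<Rightarrow> 'a \<Rightarrow> real" where
  "kernel_act M Q n g z = (\<integral>x. g x \<partial>kernel_pow M Q n z)"

text \<open>The total variation measure \<open>|\<mu>|\<close> of a signed measure, given as a real-valued set function
  \<open>\<mu>\<close> on the measurable sets of \<open>M\<close>.\<close>

definition total_variation :: "'a measure \<Rightarrow> ('a set \<Rightarrow> real) \<Rightarrow> 'a set \<Rightarrow> ennreal" where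
  "total_variation M \<mu> A =
     (SUP F\<in>{F. finite F \<and> F \<subseteq> sets M \<and> disjoint F \<and> \<Union>F = A}. \<Sum>B\<in>F. ennreal \<bar>\<mu> B\<bar>)"

definition tv_norm :: "'a measure \<Rightarrow> ('a set \<Rightarrow> real) \<Rightarrow> ennreal" where
  "tv_norm M \<mu> = total_variation M \<mu> (space M)"

definition invariant_distribution :: "'a measure \<Rightarrow> ('a \<Rightarrow> 'a measure) \<Rightarrow> 'a measure \<Rightarrow> bool" where
  "invariant_distribution M Q \<pi> \<longleftrightarrow> \<pi> \<in> space (prob_algebra M) \<and> \<pi> \<bind> Q = \<pi>"

definition UGE :: "'a measure \<Rightarrow> ('a \<Rightarrow> 'a measure) \<Rightarrow> 'a measure \<Rightarrow> nat \<Rightarrow> bool" where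
  "UGE M Q \<pi> \<tau> \<longleftrightarrow>
     invariant_distribution M Q \<pi> \<and>
     (\<forall>\<nu>. invariant_distribution M Q \<nu> \<longrightarrow> \<nu> = \<pi>) \<and>
     \<tau> \<ge> 1 \<and>
     (\<forall>n. \<forall>z\<in>space M.
        ennreal (1/2) * tv_norm M (\<lambda>A. measure (kernel_pow M Q n z) A - measure \<pi> A)
          \<le> ennreal ((1/4) ^ (n div \<tau>)))"

text \<open>The law of the canonical chain on the sequence space \<open>Pi\<^sub>M UNIV (\<lambda>_. M)\<close>, obtained from
  the Ionescu-Tulcea theorem; the chain itself is the coordinate process \<open>Z\<^sub>k \<omega> = \<omega> k\<close>.\<close>

definition chain_step ::
  "('a \<Rightarrow> 'a measure) \<Rightarrow> 'a measure \<Rightarrow> nat \<Rightarrow> (nat \<Rightarrow> 'a) \<Rightarrow> 'a measure" where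
  "chain_step Q \<nu> i \<omega> = (case i of 0 \<Rightarrow> \<nu> | Suc k \<Rightarrow> Q (\<omega> k))"

definition chain_law :: "'a measure \<Rightarrow> ('a \<Rightarrow> 'a measure) \<Rightarrow> 'a measure \<Rightarrow> (nat \<Rightarrow> 'a) measure" where
  "chain_law M Q \<nu> =
     projective_family.lim UNIV (Ionescu_Tulcea.CI (chain_step Q \<nu>) (\<lambda>_. M)) (\<lambda>_. M)"

lemma Ionescu_Tulcea_chain_step:
  assumes Q: "Q \<in> M \<rightarrow>\<^sub>M prob_algebra M" and \<nu>: "\<nu> \<in> space (prob_algebra M)"
  shows "Ionescu_Tulcea (chain_step Q \<nu>) (\<lambda>_. M)"
proof (rule Ionescu_Tulcea.intro)
  fix i
  show "chain_step Q \<nu> i \<in> Pi\<^sub>M {0..<i} (\<lambda>_. M) \<rightarrow>\<^sub>M subprob_algebra M"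
  proof (cases i)
    case 0
    then show ?thesis
      using \<nu> by (auto simp: chain_step_def[abs_def] space_prob_algebra space_subprob_algebra
          prob_space_imp_subprob_space)
  next
    case (Suc k)
    have "(\<lambda>\<omega>. \<omega> k) \<in> Pi\<^sub>M {0..<i} (\<lambda>_. M) \<rightarrow>\<^sub>M M"
      using Suc by (intro measurable_component_singleton) simp
    from measurable_compose[OF this measurable_prob_algebraD[OF Q]] show ?thesis
      using Suc by (simp add: chain_step_def[abs_def])
  qed
next
  fix i :: nat and x :: "nat \<Rightarrow> 'a" assume x: "x \<in> space (Pi\<^sub>M {0..<i} (\<lambda>_. M))"
  show "prob_space (chain_step Q \<nu> i x)"
  proof (cases i)
    case 0
    then show ?thesis using \<nu> by (simp add: chain_step_def space_prob_algebra)
  next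
    case (Suc k)
    then have "x k \<in> space M" using x by (auto simp: space_PiM PiE_iff)
    from measurable_space[OF Q this] show ?thesis
      using Suc by (simp add: chain_step_def space_prob_algebra)
  qed
qed

definition sup_norm :: "'a measure \<Rightarrow> ('a \<Rightarrow> real) \<Rightarrow> real" where
  "sup_norm M f = (SUP z\<in>space M. \<bar>f z\<bar>)"

definition centered :: "'a measure \<Rightarrow> ('a \<Rightarrow> real) \<Rightarrow> 'a \<Rightarrow> real" where
  "centered \<pi> f z = f z - (\<integral>x. f x \<partial>\<pi>)"

definition chain_sum :: "'a measure \<Rightarrow> ('a \<Rightarrow> real) \<Rightarrow> nat \<Rightarrow> (nat \<Rightarrow> 'a) \<Rightarrow> real" where
  "chain_sum \<pi> f n \<omega> = (\<Sum>l<n. f (\<omega> l) - (\<integral>x. f x \<partial>\<pi>))"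

definition asymp_var ::
  "'a measure \<Rightarrow> ('a \<Rightarrow> 'a measure) \<Rightarrow> 'a measure \<Rightarrow> ('a \<Rightarrow> real) \<Rightarrow> real" where
  "asymp_var M Q \<pi> f =
     (\<integral>z. (centered \<pi> f z)\<^sup>2 \<partial>\<pi>) +
     2 * (\<Sum>l. \<integral>z. centered \<pi> f z * kernel_act M Q (Suc l) (centered \<pi> f) z \<partial>\<pi>)"

definition C\<^sub>1 :: real where "C\<^sub>1 = 60 * exp 1"
definition C\<^sub>2 :: real where "C\<^sub>2 = 60"
definition D\<^sub>1 :: real where "D\<^sub>1 = 16/3 * sqrt (19/3) * C\<^sub>1"
definition D\<^sub>2 :: real where "D\<^sub>2 = 32/3 * (sqrt C\<^sub>2 * C\<^sub>1\<^sup>2 + C\<^sub>2)"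

definition ln_tilde :: "real \<Rightarrow> real" where
  "ln_tilde s = ln s * log 2 (2 * ln s)"

end

theory Submission
  imports Defs
begin

text \<open>
  Let \<open>h = f - \<pi>(f)\<close> and let \<open>g = \<Sum>\<^sub>k Q\<^sup>k h\<close> solve the Poisson equation \<open>Q g = g - h\<close>; mixing gives \<open>|g| \<le> 8/3 \<tau> |f|\<close>.
  The function \<open>x \<mapsto> exp (x - x\<^sup>2)\<close> is concave near \<open>0\<close>, so for small \<open>\<theta>\<close> Jensen's inequality yields
  \<open>Q exp (\<theta> g - \<theta>\<^sup>2 g\<^sup>2) \<le> exp (\<theta> Q g - \<theta>\<^sup>2 (Q g)\<^sup>2) = exp (\<theta> g - \<theta>\<^sup>2 g\<^sup>2 - \<theta> h + \<theta>\<^sup>2 v)\<close> with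
  \<open>v = 2 h g - h\<^sup>2\<close>. Hence \<open>exp (\<theta> S\<^sub>n - \<theta>\<^sup>2 \<Sum> v(Z\<^sub>l))\<close> has expectation bounded by a constant.
  Since \<open>\<pi>(v)\<close> is the asymptotic variance and \<open>|v|\<close> is of order \<open>\<tau> |f|\<^sup>2\<close>, the same bound applied to \<open>v\<close>
  with parameter \<open>\<theta>\<^sup>2\<close> replaces \<open>\<theta>\<^sup>2 \<Sum> v(Z\<^sub>l)\<close> by \<open>n \<theta>\<^sup>2 \<sigma>\<^sup>2\<close> at the cost of a term of order
  \<open>n \<theta>\<^sup>4 \<tau>\<^sup>3 |f|\<^sup>4\<close>. Optimising Chernoff's bound over \<open>\<theta>\<close> gives the three terms of the estimate.
\<close>

section \<open>Integrals against measures that are close in total variation\<close>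

text \<open>\<open>tv_norm\<close> is a supremum over finite partitions, so \<open>f\<close> is
  rounded down to multiples of a mesh \<open>\<epsilon>\<close>. The rounded function
  \<open>h\<close> takes finitely many values and its level sets form such a partition, so its two
  integrals differ by at most its sup norm times the sum of
  \<open>\<bar>d (A i)\<bar>\<close>.\<close>

lemma abs_integral_diff_le_tv_norm:
  fixes f :: "'a \<Rightarrow> real"
  assumes "prob_space \<mu>" "prob_space \<nu>" and sets: "sets \<mu> = sets M" "sets \<nu> = sets M"
    and f[measurable]: "f \<in> borel_measurable M"
    and B: "\<And>z. z \<in> space M \<Longrightarrow> \<bar>f z\<bar> \<le> B"
    and T: "tv_norm M (\<lambda>A. measure \<mu> A - measure \<nu> A) \<le> ennreal T" and "0 \<le> T"
  shows "\<bar>(\<integral>z. f z \<partial>\<mu>) - (\<integral>z. f z \<partial>\<nu>)\<bar> \<le> B * T"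
proof (rule field_le_epsilon)
  fix e :: real assume "0 < e"
  \<comment> \<open>Rounding costs at most \<open>\<epsilon>\<close> in each of the two integrals,
    and \<open>h\<close> is only bounded by \<open>B + \<epsilon>\<close>, which costs another
    \<open>\<epsilon> * T\<close>. The total error is
    \<open>\<epsilon> * (2 + T) = e\<close>.\<close>
  define \<epsilon> where "\<epsilon> = e / (2 + T)"
  have \<epsilon>: "0 < \<epsilon>" using \<open>0 < e\<close> \<open>0 \<le> T\<close> by (simp add: \<epsilon>_def)
  interpret \<mu>: prob_space \<mu> by fact
  interpret \<nu>: prob_space \<nu> by fact
  note [measurable_cong] = sets
  have space: "space \<mu> = space M" "space \<nu> = space M"
    using sets by (auto dest: sets_eq_imp_space_eq)
  define d where "d A = measure \<mu> A - measure \<nu> A" for A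
  define I where "I = {\<lfloor>- B / \<epsilon>\<rfloor>..\<lfloor>B / \<epsilon>\<rfloor>}"
  define A where "A i = {z \<in> space M. \<lfloor>f z / \<epsilon>\<rfloor> = i}" for i :: int
  define h where "h z = \<epsilon> * of_int \<lfloor>f z / \<epsilon>\<rfloor>" for z
  have [measurable, simp]: "A i \<in> sets M" for i unfolding A_def by measurable
  have A_space: "z \<in> A i \<Longrightarrow> z \<in> space M" for z i by (simp add: A_def)
  have [measurable]: "h \<in> borel_measurable M" unfolding h_def by measurable
  have inI: "\<lfloor>f z / \<epsilon>\<rfloor> \<in> I" if "z \<in> space M" for z
  proof -
    have "- B / \<epsilon> \<le> f z / \<epsilon>" "f z / \<epsilon> \<le> B / \<epsilon>"
      using B[OF that] \<epsilon> by (intro divide_right_mono; linarith)+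
    then show ?thesis by (auto simp: I_def intro!: floor_mono)
  qed
  have fh: "\<bar>f z - h z\<bar> \<le> \<epsilon>" for z
  proof -
    have "f z - h z = \<epsilon> * (f z / \<epsilon> - of_int \<lfloor>f z / \<epsilon>\<rfloor>)"
      using \<epsilon> by (simp add: h_def right_diff_distrib)
    moreover have "0 \<le> f z / \<epsilon> - of_int \<lfloor>f z / \<epsilon>\<rfloor>" "f z / \<epsilon> - of_int \<lfloor>f z / \<epsilon>\<rfloor> \<le> 1"
      by linarith+
    ultimately show ?thesis
      using \<epsilon> by (simp add: abs_mult)
  qed
  have hB: "\<bar>h z\<bar> \<le> B + \<epsilon>" if "z \<in> space M" for z
    using fh[of z] B[OF that] by linarith
  have h_sum: "h z = (\<Sum>i\<in>I. \<epsilon> * of_int i * indicator (A i) z)" if "z \<in> space M" for z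
  proof -
    have "(\<Sum>i\<in>I. \<epsilon> * of_int i * indicator (A i) z) = (\<Sum>i\<in>I. if i = \<lfloor>f z / \<epsilon>\<rfloor> then h z else 0)"
      using that by (intro sum.cong refl) (auto simp: A_def h_def indicator_def)
    also have "\<dots> = h z" using inI[OF that] by (simp add: I_def)
    finally show ?thesis ..
  qed
  have h_int: "(\<integral>z. h z \<partial>N) = (\<Sum>i\<in>I. \<epsilon> * of_int i * measure N (A i))"
    if "prob_space N" and N[measurable_cong]: "sets N = sets M" for N
  proof -
    interpret N: prob_space N by fact
    have sp: "space N = space M" using N by (rule sets_eq_imp_space_eq)
    have [simp]: "integrable N (indicat_real (A i))" for i
      by (rule integrable_real_indicator) (auto simp: N less_top[symmetric])
    have "(\<integral>z. h z \<partial>N) = (\<integral>z. (\<Sum>i\<in>I. \<epsilon> * of_int i * indicator (A i) z) \<partial>N)"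
      by (intro Bochner_Integration.integral_cong refl h_sum) (simp add: sp)
    also have "\<dots> = (\<Sum>i\<in>I. \<epsilon> * of_int i * measure N (A i))"
      by (subst Bochner_Integration.integral_sum)
         (auto simp: sp N intro!: sum.cong)
    finally show ?thesis .
  qed
  have f_h_int: "\<bar>(\<integral>z. f z \<partial>N) - (\<integral>z. h z \<partial>N)\<bar> \<le> \<epsilon>"
    if "prob_space N" and N[measurable_cong]: "sets N = sets M" for N
  proof -
    interpret N: prob_space N by fact
    have sp: "space N = space M" using N by (rule sets_eq_imp_space_eq)
    have i: "integrable N f" "integrable N h"
      by (rule N.integrable_const_bound[where B=B] N.integrable_const_bound[where B="B+\<epsilon>"];
          auto simp: sp B hB intro!: AE_I2)+
    have "\<bar>(\<integral>z. f z \<partial>N) - (\<integral>z. h z \<partial>N)\<bar> = \<bar>\<integral>z. f z - h z \<partial>N\<bar>"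
      using i by simp
    also have "\<dots> \<le> (\<integral>z. \<bar>f z - h z\<bar> \<partial>N)"
      by (rule integral_abs_bound)
    also have "\<dots> \<le> (\<integral>z. \<epsilon> \<partial>N)"
      using i fh by (intro integral_mono) auto
    finally show ?thesis by (simp add: N.prob_space)
  qed
  have disj: "i \<noteq> j \<Longrightarrow> A i \<inter> A j = {}" for i j by (auto simp: A_def)
  have "ennreal (\<Sum>i\<in>I. \<bar>d (A i)\<bar>) = (\<Sum>i\<in>I. ennreal \<bar>d (A i)\<bar>)"
    by (simp add: sum_ennreal)
  \<comment> \<open>The partition is a set of sets, so equal level sets are merged. Distinct indices
    share a level set only when it is empty, and there \<open>d\<close> vanishes.\<close>
  also have "\<dots> = (\<Sum>X\<in>A ` I. ennreal \<bar>d X\<bar>)"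
  proof (subst sum.reindex_nontrivial)
    show "finite I" by (simp add: I_def)
    show "ennreal \<bar>d (A x)\<bar> = 0" if "x \<noteq> y" "A x = A y" for x y
      using disj[OF that(1)] that(2) by (simp add: d_def)
  qed simp
  also have "\<dots> \<le> tv_norm M d"
    unfolding tv_norm_def total_variation_def
  proof (intro SUP_upper, safe)
    show "finite (A ` I)" by (simp add: I_def)
    show "disjoint (A ` I)" unfolding disjoint_def by (metis disj imageE)
    show "x \<in> \<Union> (A ` I)" if "x \<in> space M" for x
      using inI[OF that] that by (auto simp: A_def)
  qed (auto dest: A_space)
  also have "\<dots> \<le> ennreal T" using T by (simp add: d_def[abs_def])
  finally have dT: "(\<Sum>i\<in>I. \<bar>d (A i)\<bar>) \<le> T" using \<open>0 \<le> T\<close> by simp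
  have "\<bar>(\<integral>z. h z \<partial>\<mu>) - (\<integral>z. h z \<partial>\<nu>)\<bar> = \<bar>\<Sum>i\<in>I. \<epsilon> * of_int i * d (A i)\<bar>"
    using sets by (simp add: h_int \<mu>.prob_space_axioms \<nu>.prob_space_axioms d_def
        sum_subtractf[symmetric] right_diff_distrib)
  also have "\<dots> \<le> (\<Sum>i\<in>I. \<bar>\<epsilon> * of_int i * d (A i)\<bar>)" by (rule sum_abs)
  also have "\<dots> \<le> (\<Sum>i\<in>I. (B + \<epsilon>) * \<bar>d (A i)\<bar>)"
  proof (rule sum_mono)
    fix i
    show "\<bar>\<epsilon> * of_int i * d (A i)\<bar> \<le> (B + \<epsilon>) * \<bar>d (A i)\<bar>"
    \<comment> \<open>A nonempty level set contains a point where \<open>h\<close> equals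
      \<open>\<epsilon> * of_int i\<close>, which bounds this coefficient; an empty one carries no
      mass.\<close>
    proof (cases "A i = {}")
      case False
      then obtain z where "z \<in> space M" "\<lfloor>f z / \<epsilon>\<rfloor> = i" by (auto simp: A_def)
      then have "\<bar>\<epsilon> * of_int i\<bar> \<le> B + \<epsilon>" using hB[of z] by (simp add: h_def)
      then show ?thesis by (subst abs_mult) (rule mult_right_mono, simp_all)
    qed (simp add: d_def)
  qed
  also have "\<dots> = (B + \<epsilon>) * (\<Sum>i\<in>I. \<bar>d (A i)\<bar>)" by (simp add: sum_distrib_left)
  also have "\<dots> \<le> (B + \<epsilon>) * T"
  proof (rule mult_left_mono[OF dT])
    obtain z where "z \<in> space M" using \<mu>.not_empty space by auto
    then show "0 \<le> B + \<epsilon>" using hB[of z] by linarith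
  qed
  finally have "\<bar>(\<integral>z. h z \<partial>\<mu>) - (\<integral>z. h z \<partial>\<nu>)\<bar> \<le> (B + \<epsilon>) * T" .
  moreover have "(B + \<epsilon>) * T + 2 * \<epsilon> = B * T + e"
  proof -
    have "\<epsilon> * (2 + T) = e" using \<open>0 \<le> T\<close> by (simp add: \<epsilon>_def)
    then show ?thesis by (simp add: algebra_simps)
  qed
  ultimately show "\<bar>(\<integral>z. f z \<partial>\<mu>) - (\<integral>z. f z \<partial>\<nu>)\<bar> \<le> B * T + e"
    using f_h_int[OF \<mu>.prob_space_axioms sets(1)] f_h_int[OF \<nu>.prob_space_axioms sets(2)] by linarith
qed

section \<open>A function concave near zero and its Jensen inequality\<close>

text \<open>The second derivative is nonpositive as long as \<open>\<bar>1 - 2 * x\<bar>\<close> is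
  at most the square root of 2. The left end -41/200 keeps this modulus below 141/100, just under
  that root, and still lies to the left of -1/5.\<close>

lemma concave_on_exp_minus_square: "concave_on {-41/200<..<1} (\<lambda>x::real. exp (x - x\<^sup>2))"
proof (rule f''_le0_imp_concave)
  show "((\<lambda>x. exp (x - x\<^sup>2)) has_real_derivative (1 - 2 * x) * exp (x - x\<^sup>2)) (at x)" for x
    by (auto intro!: derivative_eq_intros)
  show "((\<lambda>x. (1 - 2 * x) * exp (x - x\<^sup>2)) has_real_derivative
      ((1 - 2 * x)\<^sup>2 - 2) * exp (x - x\<^sup>2)) (at x)" for x
    by (auto intro!: derivative_eq_intros simp: power2_eq_square algebra_simps)
  show "((1 - 2 * x)\<^sup>2 - 2) * exp (x - x\<^sup>2) \<le> 0" if "x \<in> {-41/200<..<1}" for x :: real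
  proof -
    have "\<bar>1 - 2 * x\<bar> \<le> 141/100"
      using that unfolding greaterThanLessThan_iff by linarith
    then have "(1 - 2 * x)\<^sup>2 \<le> (141/100)\<^sup>2" by (metis abs_ge_zero power2_abs power_mono)
    then show ?thesis by (intro mult_nonpos_nonneg) (auto simp: power2_eq_square)
  qed
qed (rule convex_real_interval)

text \<open>Jensen's inequality for that function; the values of \<open>X\<close> stay inside the
  open interval of concavity. Both sides have the same shape, which is what allows iteration along
  the chain.\<close>

lemma (in prob_space) expectation_exp_minus_square_le:
  fixes X :: "'a \<Rightarrow> real"
  assumes X[measurable]: "X \<in> borel_measurable M" and b: "\<And>x. x \<in> space M \<Longrightarrow> \<bar>X x\<bar> \<le> 1/5"
  shows "(\<integral>\<^sup>+x. ennreal (exp (X x - (X x)\<^sup>2)) \<partial>M) \<le> ennreal (exp (expectation X - (expectation X)\<^sup>2))"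
proof -
  have iX: "integrable M X"
    by (rule integrable_const_bound[where B="1/5"]) (use b in \<open>auto intro!: AE_I2\<close>)
  have i: "integrable M (\<lambda>x. exp (X x - (X x)\<^sup>2))"
  proof (rule integrable_const_bound[where B="exp (1/5)"])
    show "AE x in M. norm (exp (X x - (X x)\<^sup>2)) \<le> exp (1/5)"
    proof (rule AE_I2)
      fix x assume "x \<in> space M"
      then have "X x - (X x)\<^sup>2 \<le> 1/5"
        using b[of x] zero_le_power2[of "X x"] by linarith
      then show "norm (exp (X x - (X x)\<^sup>2)) \<le> exp (1/5)" by simp
    qed
  qed simp
  have "- exp (expectation X - (expectation X)\<^sup>2) \<le> expectation (\<lambda>x. - exp (X x - (X x)\<^sup>2))"
  proof (rule jensens_inequality[where q="\<lambda>x. - exp (x - x\<^sup>2)" and I="{-41/200<..<1}"])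
    show "AE x in M. X x \<in> {-41/200<..<1}"
      using b by (intro AE_I2) (fastforce simp: abs_le_iff)
    show "convex_on {-41/200<..<1} (\<lambda>x::real. - exp (x - x\<^sup>2))"
      using concave_on_exp_minus_square by (simp add: concave_on_def)
  qed (use iX i in auto)
  then have "expectation (\<lambda>x. exp (X x - (X x)\<^sup>2)) \<le> exp (expectation X - (expectation X)\<^sup>2)"
    by simp
  then show ?thesis
    by (subst nn_integral_eq_integral[OF i]) (auto intro!: ennreal_leI)
qed

section \<open>Expectations under the law of the chain\<close>

text \<open>Reduces the infinite product to a finite composition of kernels, where induction is
  possible: the marginal of the projective limit on the first \<open>n\<close> coordinates is
  \<open>C 0 n\<close> started from the empty history \<open>\<lambda>_. undefined\<close>.\<close>

lemma nn_integral_chain_law: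
  fixes \<Phi> :: "(nat \<Rightarrow> 'a) \<Rightarrow> ennreal"
  assumes Q: "Q \<in> M \<rightarrow>\<^sub>M prob_algebra M" and \<nu>: "\<nu> \<in> space (prob_algebra M)"
    and \<Phi>[measurable]: "\<Phi> \<in> borel_measurable (Pi\<^sub>M {0..<n} (\<lambda>_. M))"
  shows "(\<integral>\<^sup>+\<omega>. \<Phi> (restrict \<omega> {0..<n}) \<partial>chain_law M Q \<nu>)
    = (\<integral>\<^sup>+\<omega>. \<Phi> \<omega> \<partial>Ionescu_Tulcea.C (chain_step Q \<nu>) (\<lambda>_. M) 0 n (\<lambda>_. undefined))"
proof -
  interpret IT: Ionescu_Tulcea "chain_step Q \<nu>" "\<lambda>_. M"
    by (rule Ionescu_Tulcea_chain_step[OF Q \<nu>])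
  \<comment> \<open>The marginal on a finite index set is read off from \<open>C\<close> run up to
    the least bound of that set, here exactly \<open>n\<close>.\<close>
  have u: "IT.up_to {0..<n} = n"
  proof (rule antisym)
    show "IT.up_to {0..<n} \<le> n" by (simp add: IT.up_to_iff)
    show "n \<le> IT.up_to {0..<n}"
      by (rule ccontr) (use IT.up_to_less[of "{0..<n}" "IT.up_to {0..<n}"] in auto)
  qed
  note [measurable_cong] = IT.PF.sets_lim
  have "(\<integral>\<^sup>+\<omega>. \<Phi> (restrict \<omega> {0..<n}) \<partial>chain_law M Q \<nu>)
      = (\<integral>\<^sup>+\<omega>. \<Phi> \<omega> \<partial>distr IT.PF.lim (Pi\<^sub>M {0..<n} (\<lambda>_. M)) (\<lambda>\<omega>. restrict \<omega> {0..<n}))"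
    unfolding chain_law_def by (subst nn_integral_distr) auto
  also have "\<dots> = (\<integral>\<^sup>+\<omega>. \<Phi> (restrict \<omega> {0..<n}) \<partial>IT.C 0 n (\<lambda>_. undefined))"
    by (subst IT.distr_lim) (auto simp: IT.CI_def u nn_integral_distr 
        measurable_cong_sets[OF IT.sets_C[of "\<lambda>_. undefined" 0 n] refl])
  also have "\<dots> = (\<integral>\<^sup>+\<omega>. \<Phi> \<omega> \<partial>IT.C 0 n (\<lambda>_. undefined))"
    by (rule nn_integral_cong) (auto simp: IT.space_C space_PiM PiE_restrict simp del: restrict_apply)
  finally show ?thesis .
qed

text \<open>Given the states up to time \<open>n\<close>, the drift condition bounds the conditional
  mean of \<open>w (\<omega> n) * V (\<omega> (Suc n))\<close> by \<open>V (\<omega> n)\<close>. The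
  weighted products therefore form a supermartingale, whose mean never exceeds the initial
  one.\<close>

lemma chain_law_supermartingale:
  fixes V w :: "'a \<Rightarrow> ennreal"
  assumes Q: "Q \<in> M \<rightarrow>\<^sub>M prob_algebra M" and \<nu>: "\<nu> \<in> space (prob_algebra M)"
    and [measurable]: "V \<in> borel_measurable M" "w \<in> borel_measurable M"
    and drift: "\<And>z. z \<in> space M \<Longrightarrow> w z * (\<integral>\<^sup>+x. V x \<partial>Q z) \<le> V z"
  shows "(\<integral>\<^sup>+\<omega>. (\<Prod>l<n. w (\<omega> l)) * V (\<omega> n) \<partial>chain_law M Q \<nu>) \<le> (\<integral>\<^sup>+x. V x \<partial>\<nu>)"
proof -
  interpret IT: Ionescu_Tulcea "chain_step Q \<nu>" "\<lambda>_. M"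
    by (rule Ionescu_Tulcea_chain_step[OF Q \<nu>])
  let ?C = "\<lambda>n. IT.C 0 n (\<lambda>_. undefined)"
  let ?F = "\<lambda>n \<omega>. (\<Prod>l<n. w (\<omega> l)) * V (\<omega> n)"
  have F[measurable]: "?F n \<in> borel_measurable (Pi\<^sub>M {0..<Suc n} (\<lambda>_. M))" for n
    by measurable
  have und: "(\<lambda>_. undefined) \<in> space (Pi\<^sub>M {0..<0::nat} (\<lambda>_. M))" by simp
  have eP: "IT.eP n \<in> ?C n \<rightarrow>\<^sub>M subprob_algebra (Pi\<^sub>M {0..<Suc n} (\<lambda>_. M))" for n
    using IT.measurable_eP[of n] IT.sets_C[OF und, of n] by (simp cong: measurable_cong_sets)
  \<comment> \<open>\<open>?F n\<close> reads the coordinates 0 to \<open>n\<close>, hence a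
    composition of \<open>Suc n\<close> steps: the first draws from \<open>\<nu>\<close>, the others
    from \<open>Q\<close>.\<close>
  have "(\<integral>\<^sup>+\<omega>. ?F n \<omega> \<partial>?C (Suc n)) \<le> (\<integral>\<^sup>+x. V x \<partial>\<nu>)"
  proof (induction n)
    case 0
    have "(\<integral>\<^sup>+\<omega>. ?F 0 \<omega> \<partial>?C (Suc 0)) = (\<integral>\<^sup>+\<omega>. ?F 0 \<omega> \<partial>IT.eP 0 (\<lambda>_. undefined))"
      using bind_return[OF IT.measurable_eP[of 0] und] by simp
    also have "\<dots> = (\<integral>\<^sup>+x. V x \<partial>\<nu>)"
      by (subst IT.nn_integral_eP[OF und F]) (simp add: chain_step_def)
    finally show ?case by simp
  next
    case (Suc n)
    have "(\<integral>\<^sup>+\<omega>. ?F (Suc n) \<omega> \<partial>?C (Suc (Suc n)))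
        = (\<integral>\<^sup>+\<omega>. \<integral>\<^sup>+\<omega>'. ?F (Suc n) \<omega>' \<partial>IT.eP (Suc n) \<omega> \<partial>?C (Suc n))"
      using nn_integral_bind[OF F[of "Suc n"] eP[of "Suc n"]] by simp
    also have "\<dots> \<le> (\<integral>\<^sup>+\<omega>. ?F n \<omega> \<partial>?C (Suc n))"
    proof (rule nn_integral_mono)
      fix \<omega> assume "\<omega> \<in> space (?C (Suc n))"
      then have \<omega>: "\<omega> \<in> space (Pi\<^sub>M {0..<Suc n} (\<lambda>_. M))"
        using IT.space_C[OF und, of "Suc n"] by simp
      then have \<omega>n: "\<omega> n \<in> space M" by (auto simp: space_PiM PiE_iff)
      have [measurable_cong]: "sets (Q (\<omega> n)) = sets M"
        using measurable_space[OF Q \<omega>n] by (simp add: space_prob_algebra)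
      \<comment> \<open>The new coordinate \<open>Suc n\<close> has law
        \<open>Q (\<omega> n)\<close>; the weights read earlier coordinates only and leave the
        integral as constants.\<close>
      have "(\<integral>\<^sup>+\<omega>'. ?F (Suc n) \<omega>' \<partial>IT.eP (Suc n) \<omega>)
          = (\<integral>\<^sup>+x. (\<Prod>l<Suc n. w (\<omega> l)) * V x \<partial>Q (\<omega> n))"
        by (subst IT.nn_integral_eP[OF \<omega> F]) (simp add: chain_step_def)
      also have "\<dots> = (\<Prod>l<n. w (\<omega> l)) * (w (\<omega> n) * (\<integral>\<^sup>+x. V x \<partial>Q (\<omega> n)))"
        by (subst nn_integral_cmult) (auto simp: mult.assoc)
      also have "\<dots> \<le> ?F n \<omega>"
        by (intro mult_left_mono drift[OF \<omega>n]) simp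
      finally show "(\<integral>\<^sup>+\<omega>'. ?F (Suc n) \<omega>' \<partial>IT.eP (Suc n) \<omega>) \<le> ?F n \<omega>" .
    qed
    also note Suc.IH
    finally show ?case .
  qed
  moreover have "(\<integral>\<^sup>+\<omega>. ?F n \<omega> \<partial>chain_law M Q \<nu>) = (\<integral>\<^sup>+\<omega>. ?F n \<omega> \<partial>?C (Suc n))"
    using nn_integral_chain_law[OF Q \<nu> F[of n]] by simp
  ultimately show ?thesis by simp
qed

lemma
  assumes Q: "Q \<in> M \<rightarrow>\<^sub>M prob_algebra M" and \<nu>: "\<nu> \<in> space (prob_algebra M)"
  shows prob_space_chain_law: "prob_space (chain_law M Q \<nu>)"
    and sets_chain_law: "sets (chain_law M Q \<nu>) = sets (Pi\<^sub>M UNIV (\<lambda>_. M))"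
proof -
  interpret IT: Ionescu_Tulcea "chain_step Q \<nu>" "\<lambda>_. M"
    by (rule Ionescu_Tulcea_chain_step[OF Q \<nu>])
  show "sets (chain_law M Q \<nu>) = sets (Pi\<^sub>M UNIV (\<lambda>_. M))"
    by (simp add: chain_law_def)
  have "(\<integral>\<^sup>+\<omega>. 1 \<partial>chain_law M Q \<nu>) = (\<integral>\<^sup>+\<omega>. 1 \<partial>IT.C 0 0 (\<lambda>_. undefined))"
    using nn_integral_chain_law[OF Q \<nu>, of "\<lambda>_. 1" 0] by simp
  also have "\<dots> = 1"
    using IT.prob_space_C[of "\<lambda>_. undefined" 0 0, THEN prob_space.emeasure_space_1]
    by (simp del: IT.C.simps)
  finally show "prob_space (chain_law M Q \<nu>)"
    by (intro prob_spaceI) simp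
qed

text \<open>The exponent is constant on blocks of length \<tau>, so the series is at most \<tau>
  times the geometric series of ratio 1/4, whose sum is 4/3. One bound on all partial sums gives
  both convergence and the estimate.\<close>

lemma
  assumes "\<tau> \<ge> 1"
  shows summable_quarter_power_div: "summable (\<lambda>k. (1/4::real) ^ (k div \<tau>))"
    and suminf_quarter_power_div_le: "(\<Sum>k. (1/4::real) ^ (k div \<tau>)) \<le> 4/3 * real \<tau>"
proof -
  have bound: "(\<Sum>k<n. (1/4::real) ^ (k div \<tau>)) \<le> 4/3 * real \<tau>" for n
  proof -
    \<comment> \<open>As \<tau> is at least 1, the range \<open>n * \<tau>\<close> contains the old
      one and consists of complete blocks.\<close>
    have "(\<Sum>k<n. (1/4::real) ^ (k div \<tau>)) \<le> (\<Sum>k<n * \<tau>. (1/4) ^ (k div \<tau>))"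
      using assms by (intro sum_mono2) auto
    also have "\<dots> = (\<Sum>m<n. \<Sum>k\<in>{m * \<tau>..<m * \<tau> + \<tau>}. (1/4) ^ (k div \<tau>))"
      by (rule sum.nat_group[symmetric])
    also have "\<dots> = (\<Sum>m<n. \<Sum>k\<in>{m * \<tau>..<m * \<tau> + \<tau>}. (1/4) ^ m)"
    proof (intro sum.cong refl)
      fix m k assume "k \<in> {m * \<tau>..<m * \<tau> + \<tau>}"
      then have "k div \<tau> = m"
        by (intro div_nat_eqI) (auto simp: algebra_simps)
      then show "(1/4::real) ^ (k div \<tau>) = (1/4) ^ m" by simp
    qed
    also have "\<dots> = real \<tau> * (\<Sum>m<n. (1/4) ^ m)"
      by (simp add: sum_distrib_left)
    also have "\<dots> \<le> real \<tau> * (4/3)"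
      by (intro mult_left_mono) (simp_all add: sum_gp_strict)
    finally show ?thesis by simp
  qed
  show *: "summable (\<lambda>k. (1/4::real) ^ (k div \<tau>))"
    by (rule summableI_nonneg_bounded[OF _ bound]) simp
  show "(\<Sum>k. (1/4::real) ^ (k div \<tau>)) \<le> 4/3 * real \<tau>"
    by (rule suminf_le_const[OF * bound])
qed

section \<open>The ergodic kernel, its iterates and their mixing rate\<close>

locale uniformly_ergodic_kernel =
  fixes M :: "'a measure" and Q :: "'a \<Rightarrow> 'a measure" and \<pi> :: "'a measure" and \<tau> :: nat
  assumes Q: "Q \<in> M \<rightarrow>\<^sub>M prob_algebra M" and UGE: "UGE M Q \<pi> \<tau>"
begin

lemma Q_subprob[measurable]: "Q \<in> M \<rightarrow>\<^sub>M subprob_algebra M"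
  using Q by (rule measurable_prob_algebraD)

lemma
  assumes "z \<in> space M"
  shows prob_space_Q: "prob_space (Q z)" and sets_Q: "sets (Q z) = sets M"
    and space_Q: "space (Q z) = space M"
  using measurable_space[OF Q assms] by (auto simp: space_prob_algebra dest: sets_eq_imp_space_eq)

lemma \<pi>: "\<pi> \<in> space (prob_algebra M)" and bind_\<pi>: "\<pi> \<bind> Q = \<pi>" and \<tau>: "1 \<le> \<tau>"
  using UGE by (auto simp: UGE_def invariant_distribution_def)

lemma sets_\<pi>[measurable_cong]: "sets \<pi> = sets M" and space_\<pi>: "space \<pi> = space M"
  using \<pi> by (auto simp: space_prob_algebra dest: sets_eq_imp_space_eq)

sublocale \<pi>: prob_space \<pi>
  using \<pi> by (simp add: space_prob_algebra)

lemma integrable_\<pi>: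
  fixes u :: "'a \<Rightarrow> real"
  assumes "u \<in> borel_measurable M" "\<And>z. z \<in> space M \<Longrightarrow> \<bar>u z\<bar> \<le> B"
  shows "integrable \<pi> u"
  using assms by (intro \<pi>.integrable_const_bound[where B=B]) (auto simp: space_\<pi> sets_\<pi> cong: measurable_cong_sets)

lemma integrable_Q:
  fixes u :: "'a \<Rightarrow> real"
  assumes "u \<in> borel_measurable M" "\<And>z. z \<in> space M \<Longrightarrow> \<bar>u z\<bar> \<le> B" "z \<in> space M"
  shows "integrable (Q z) u"
proof -
  interpret prob_space "Q z" using assms(3) by (rule prob_space_Q)
  show ?thesis
    using assms by (intro integrable_const_bound[where B=B]) (auto simp: space_Q sets_Q cong: measurable_cong_sets)
qed

lemma kernel_pow: "kernel_pow M Q n \<in> M \<rightarrow>\<^sub>M prob_algebra M"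
proof (induction n)
  case 0
  then show ?case using measurable_return_prob_space[of M] by (simp cong: measurable_cong)
next
  case (Suc n)
  from measurable_bind_prob_space[OF Suc.IH Q] show ?case by (simp cong: measurable_cong)
qed

lemma
  assumes "z \<in> space M"
  shows prob_space_kernel_pow: "prob_space (kernel_pow M Q n z)"
    and sets_kernel_pow: "sets (kernel_pow M Q n z) = sets M"
    and space_kernel_pow: "space (kernel_pow M Q n z) = space M"
  using measurable_space[OF kernel_pow assms] by (auto simp: space_prob_algebra dest: sets_eq_imp_space_eq)

lemma kernel_act_measurable[measurable]:
  assumes [measurable]: "u \<in> borel_measurable M"
  shows "kernel_act M Q n u \<in> borel_measurable M"
  unfolding kernel_act_def[abs_def]
  using measurable_compose[OF measurable_prob_algebraD[OF kernel_pow] integral_measurable_subprob_algebra[OF assms]] .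

lemma centered_measurable[measurable]:
  "u \<in> borel_measurable M \<Longrightarrow> centered \<pi> u \<in> borel_measurable M"
  unfolding centered_def[abs_def] by (intro borel_measurable_diff borel_measurable_const)

lemma abs_integral_\<pi>_le:
  fixes u :: "'a \<Rightarrow> real"
  assumes "u \<in> borel_measurable M" "\<And>z. z \<in> space M \<Longrightarrow> \<bar>u z\<bar> \<le> B"
  shows "\<bar>\<integral>x. u x \<partial>\<pi>\<bar> \<le> B"
proof -
  have "\<bar>\<integral>x. u x \<partial>\<pi>\<bar> \<le> (\<integral>x. \<bar>u x\<bar> \<partial>\<pi>)" by (rule integral_abs_bound)
  also have "\<dots> \<le> (\<integral>x. B \<partial>\<pi>)"
    using assms by (intro integral_mono integrable_abs integrable_\<pi>[OF assms]) (auto simp: space_\<pi>)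
  finally show ?thesis by (simp add: \<pi>.prob_space)
qed

lemma abs_centered_le:
  assumes "u \<in> borel_measurable M" "\<And>z. z \<in> space M \<Longrightarrow> \<bar>u z\<bar> \<le> B" "z \<in> space M"
  shows "\<bar>centered \<pi> u z\<bar> \<le> 2 * B"
  using abs_integral_\<pi>_le[OF assms(1,2)] assms(2)[OF assms(3)] by (simp add: centered_def)

text \<open>Integrating the centred function gives the difference of the integrals of
  \<open>u\<close> against the iterated kernel and against \<pi>, which total variation controls.
  The factor 2 undoes the 1/2 in \<open>UGE\<close>; since \<open>u\<close> itself is bounded by
  \<open>B\<close>, centring costs no further factor.\<close>

lemma abs_kernel_act_centered_le:
  assumes u[measurable]: "u \<in> borel_measurable M" and B: "\<And>z. z \<in> space M \<Longrightarrow> \<bar>u z\<bar> \<le> B"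
    and z: "z \<in> space M"
  shows "\<bar>kernel_act M Q n (centered \<pi> u) z\<bar> \<le> 2 * B * (1/4) ^ (n div \<tau>)"
proof -
  interpret K: prob_space "kernel_pow M Q n z" using z by (rule prob_space_kernel_pow)
  have "integrable (kernel_pow M Q n z) u"
    using B by (intro K.integrable_const_bound[where B=B])
       (auto simp: space_kernel_pow[OF z] sets_kernel_pow[OF z] cong: measurable_cong_sets)
  then have eq: "kernel_act M Q n (centered \<pi> u) z = (\<integral>x. u x \<partial>kernel_pow M Q n z) - (\<integral>x. u x \<partial>\<pi>)"
    by (simp add: kernel_act_def centered_def K.prob_space)
  let ?t = "tv_norm M (\<lambda>A. measure (kernel_pow M Q n z) A - measure \<pi> A)"
  have "?t = ennreal 2 * (ennreal (1/2) * ?t)"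
    by (subst mult.assoc[symmetric], subst ennreal_mult[symmetric]) auto
  also have "\<dots> \<le> ennreal 2 * ennreal ((1/4) ^ (n div \<tau>))"
    using UGE z by (intro mult_left_mono) (auto simp: UGE_def)
  also have "\<dots> = ennreal (2 * (1/4) ^ (n div \<tau>))"
    by (rule ennreal_mult[symmetric]) auto
  finally have "?t \<le> ennreal (2 * (1/4) ^ (n div \<tau>))" .
  from abs_integral_diff_le_tv_norm[OF K.prob_space_axioms \<pi>.prob_space_axioms
      sets_kernel_pow[OF z] sets_\<pi> u B this]
  show ?thesis by (simp add: eq mult_ac)
qed

lemma kernel_act_0: "u \<in> borel_measurable M \<Longrightarrow> z \<in> space M \<Longrightarrow> kernel_act M Q 0 u z = u z"
  by (simp add: kernel_act_def integral_return)

lemma kernel_act_Suc_right: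
  assumes u: "u \<in> borel_measurable M" "\<And>z. z \<in> space M \<Longrightarrow> \<bar>u z\<bar> \<le> B" and z: "z \<in> space M"
  shows "kernel_act M Q (Suc n) u z = kernel_act M Q n (\<lambda>x. \<integral>y. u y \<partial>Q x) z"
proof -
  interpret K: prob_space "kernel_pow M Q n z" using z by (rule prob_space_kernel_pow)
  show ?thesis
    unfolding kernel_act_def kernel_pow.simps
  proof (rule integral_bind[OF u])
    show "Q \<in> kernel_pow M Q n z \<rightarrow>\<^sub>M subprob_algebra M"
      using Q_subprob sets_kernel_pow[OF z, of n] by (simp cong: measurable_cong_sets)
    show "AE x in kernel_pow M Q n z. emeasure (Q x) (space (Q x)) \<le> ennreal 1"
      by (intro AE_I2) (simp add: space_kernel_pow[OF z] prob_space.emeasure_space_1[OF prob_space_Q])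
  qed (auto intro: K.finite_measure_axioms)
qed

text \<open>\<open>kernel_pow\<close> adds its new step last, whereas the Poisson equation needs
  \<open>Q\<close> outermost. The induction generalises over \<open>u\<close> because its hypothesis
  is applied to the one-step average \<open>?v\<close> of \<open>u\<close>.\<close>

lemma kernel_act_Suc_left:
  assumes "u \<in> borel_measurable M" "\<And>z. z \<in> space M \<Longrightarrow> \<bar>u z\<bar> \<le> B" and "z \<in> space M"
  shows "kernel_act M Q (Suc n) u z = (\<integral>x. kernel_act M Q n u x \<partial>Q z)"
  using assms
proof (induction n arbitrary: u z)
  case 0
  have [measurable]: "u \<in> borel_measurable M" by fact
  have "kernel_act M Q (Suc 0) u z = (\<integral>y. u y \<partial>Q z)"
    using 0 by (subst kernel_act_Suc_right[OF 0]) (auto intro!: kernel_act_0)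
  also have "\<dots> = (\<integral>x. kernel_act M Q 0 u x \<partial>Q z)"
    using 0 by (intro Bochner_Integration.integral_cong refl) (simp add: kernel_act_0 space_Q)
  finally show ?case .
next
  case (Suc n)
  let ?v = "\<lambda>x. \<integral>y. u y \<partial>Q x"
  have [measurable]: "u \<in> borel_measurable M" by fact
  have vm: "?v \<in> borel_measurable M" by measurable
  have vB: "\<bar>?v x\<bar> \<le> B" if x: "x \<in> space M" for x
  proof -
    interpret prob_space "Q x" using x by (rule prob_space_Q)
    have "\<bar>?v x\<bar> \<le> (\<integral>y. \<bar>u y\<bar> \<partial>Q x)" by (rule integral_abs_bound)
    also have "\<dots> \<le> (\<integral>y. B \<partial>Q x)"
      using Suc.prems(2) by (intro integral_mono integrable_abs integrable_Q[OF Suc.prems(1,2) x]) (auto simp: space_Q[OF x])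
    finally show ?thesis by (simp add: prob_space)
  qed
  have "kernel_act M Q (Suc (Suc n)) u z = kernel_act M Q (Suc n) ?v z"
    by (rule kernel_act_Suc_right[OF Suc.prems])
  also have "\<dots> = (\<integral>x. kernel_act M Q n ?v x \<partial>Q z)"
    using vm vB Suc.prems(3) by (rule Suc.IH)
  also have "\<dots> = (\<integral>x. kernel_act M Q (Suc n) u x \<partial>Q z)"
    using Suc.prems by (intro Bochner_Integration.integral_cong refl kernel_act_Suc_right[symmetric]) (auto simp: space_Q)
  finally show ?case .
qed

lemma integral_\<pi>_Q:
  fixes u :: "'a \<Rightarrow> real"
  assumes u: "u \<in> borel_measurable M" "\<And>z. z \<in> space M \<Longrightarrow> \<bar>u z\<bar> \<le> B"
  shows "(\<integral>x. (\<integral>y. u y \<partial>Q x) \<partial>\<pi>) = (\<integral>x. u x \<partial>\<pi>)"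
proof -
  have "(\<integral>x. u x \<partial>(\<pi> \<bind> Q)) = (\<integral>x. (\<integral>y. u y \<partial>Q x) \<partial>\<pi>)"
  proof (rule integral_bind[OF u])
    show "Q \<in> \<pi> \<rightarrow>\<^sub>M subprob_algebra M" by measurable
    show "AE x in \<pi>. emeasure (Q x) (space (Q x)) \<le> ennreal 1"
      by (intro AE_I2) (simp add: space_\<pi> prob_space.emeasure_space_1[OF prob_space_Q])
  qed (auto intro: \<pi>.finite_measure_axioms)
  then show ?thesis by (simp add: bind_\<pi>)
qed

section \<open>The Poisson equation and the asymptotic variance\<close>

definition poisson_solution :: "('a \<Rightarrow> real) \<Rightarrow> 'a \<Rightarrow> real" where
  "poisson_solution u z = (\<Sum>k. kernel_act M Q k (centered \<pi> u) z)"

text \<open>For bounded \<open>u\<close> and \<open>g = poisson_solution u\<close> this is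
  \<open>g\<^sup>2 - (Q g)\<^sup>2\<close>. It differs from the one-step conditional variance
  \<open>Q g\<^sup>2 - (Q g)\<^sup>2\<close> by \<open>g\<^sup>2 - Q g\<^sup>2\<close>, which has
  \<pi>-mean zero.\<close>

definition variance_density :: "('a \<Rightarrow> real) \<Rightarrow> 'a \<Rightarrow> real" where
  "variance_density u z = 2 * centered \<pi> u z * poisson_solution u z - (centered \<pi> u z)\<^sup>2"

lemma poisson_solution_measurable[measurable]:
  assumes [measurable]: "u \<in> borel_measurable M"
  shows "poisson_solution u \<in> borel_measurable M"
  unfolding poisson_solution_def[abs_def] by measurable

lemma variance_density_measurable[measurable]:
  assumes [measurable]: "u \<in> borel_measurable M"
  shows "variance_density u \<in> borel_measurable M"
  unfolding variance_density_def[abs_def] by measurable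

context
  fixes u :: "'a \<Rightarrow> real" and B :: real
  assumes u[measurable]: "u \<in> borel_measurable M" and B: "\<And>z. z \<in> space M \<Longrightarrow> \<bar>u z\<bar> \<le> B"
begin

lemma bound_nonneg: "0 \<le> B"
proof -
  obtain z where "z \<in> space M" using \<pi>.not_empty by (auto simp: space_\<pi>)
  then show ?thesis using B[of z] by linarith
qed

lemma summable_bound: "summable (\<lambda>k. c * (1/4::real) ^ (k div \<tau>))"
  by (intro summable_mult summable_quarter_power_div \<tau>)

lemma summable_abs_kernel_act:
  "z \<in> space M \<Longrightarrow> summable (\<lambda>k. \<bar>kernel_act M Q k (centered \<pi> u) z\<bar>)"
  by (rule summable_comparison_test'[OF summable_bound[of "2 * B"], of 0])
     (simp add: abs_kernel_act_centered_le[OF u B])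

lemma summable_kernel_act:
  "z \<in> space M \<Longrightarrow> summable (\<lambda>k. kernel_act M Q k (centered \<pi> u) z)"
  by (rule summable_rabs_cancel[OF summable_abs_kernel_act])

lemma abs_poisson_solution_le:
  assumes z: "z \<in> space M"
  shows "\<bar>poisson_solution u z\<bar> \<le> 8/3 * real \<tau> * B"
proof -
  have "\<bar>poisson_solution u z\<bar> \<le> (\<Sum>k. \<bar>kernel_act M Q k (centered \<pi> u) z\<bar>)"
    unfolding poisson_solution_def by (rule summable_rabs[OF summable_abs_kernel_act[OF z]])
  also have "\<dots> \<le> (\<Sum>k. 2 * B * (1/4) ^ (k div \<tau>))"
    by (intro suminf_le summable_bound summable_abs_kernel_act z abs_kernel_act_centered_le[OF u B])
  also have "\<dots> = 2 * B * (\<Sum>k. (1/4) ^ (k div \<tau>))"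
    by (rule suminf_mult[OF summable_quarter_power_div[OF \<tau>]])
  also have "\<dots> \<le> 2 * B * (4/3 * real \<tau>)"
    using bound_nonneg by (intro mult_left_mono suminf_quarter_power_div_le \<tau>) auto
  finally show ?thesis by (simp add: mult_ac)
qed

text \<open>\<open>Q\<close> shifts the series by one index and the term lost is the zeroth one, the
  centred function itself. The geometric bound justifies integrating term by term.\<close>

lemma poisson_equation:
  assumes z: "z \<in> space M"
  shows "(\<integral>x. poisson_solution u x \<partial>Q z) = poisson_solution u z - centered \<pi> u z"
proof -
  let ?a = "\<lambda>k. kernel_act M Q k (centered \<pi> u)"
  interpret prob_space "Q z" using z by (rule prob_space_Q)
  have a: "?a k \<in> borel_measurable M" for k by measurable
  note int = integrable_Q[OF a abs_kernel_act_centered_le[OF u B] z]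
  have "(\<integral>x. poisson_solution u x \<partial>Q z) = (\<Sum>k. \<integral>x. ?a k x \<partial>Q z)"
    unfolding poisson_solution_def
  proof (rule integral_suminf)
    show "integrable (Q z) (?a k)" for k by (rule int)
    show "AE x in Q z. summable (\<lambda>k. norm (?a k x))"
      by (intro AE_I2) (simp add: space_Q[OF z] summable_abs_kernel_act)
    show "summable (\<lambda>k. \<integral>x. norm (?a k x) \<partial>Q z)"
    proof (rule summable_comparison_test'[OF summable_bound[of "2 * B"], of 0])
      fix k
      have "(\<integral>x. \<bar>?a k x\<bar> \<partial>Q z) \<le> (\<integral>x. 2 * B * (1/4) ^ (k div \<tau>) \<partial>Q z)"
        using int by (intro integral_mono integrable_abs)
           (auto simp: space_Q[OF z] intro!: abs_kernel_act_centered_le[OF u B])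
      then show "norm (\<integral>x. norm (?a k x) \<partial>Q z) \<le> 2 * B * (1/4) ^ (k div \<tau>)"
        by (simp add: prob_space)
    qed
  qed
  also have "\<dots> = (\<Sum>k. ?a (Suc k) z)"
    using abs_centered_le[OF u B] by (intro suminf_cong kernel_act_Suc_left[symmetric] z) auto
  also have "\<dots> = poisson_solution u z - ?a 0 z"
    unfolding poisson_solution_def by (rule suminf_split_head[OF summable_kernel_act[OF z]])
  finally show ?thesis using z by (simp add: kernel_act_0)
qed

text \<open>The density factors as \<open>?c * (2 * ?g - ?c)\<close>. The second factor is at most
  \<open>16/3 * \<tau> * B + 2 * B\<close>, and \<tau> \<ge> 1 turns this into
  \<open>22/3 * \<tau> * B\<close>.\<close>

lemma abs_variance_density_le:
  assumes z: "z \<in> space M"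
  shows "\<bar>variance_density u z\<bar> \<le> 44/3 * real \<tau> * B\<^sup>2"
proof -
  let ?c = "centered \<pi> u z" and ?g = "poisson_solution u z"
  have c: "\<bar>?c\<bar> \<le> 2 * B" by (rule abs_centered_le[OF u B z])
  have "B \<le> real \<tau> * B" using bound_nonneg \<tau> mult_right_mono[of 1 "real \<tau>" B] by simp
  then have g: "\<bar>2 * ?g - ?c\<bar> \<le> 22/3 * (real \<tau> * B)"
    using abs_poisson_solution_le[OF z] c by linarith
  have "\<bar>variance_density u z\<bar> = \<bar>?c\<bar> * \<bar>2 * ?g - ?c\<bar>"
    by (simp add: variance_density_def abs_mult[symmetric] power2_eq_square algebra_simps)
  also have "\<dots> \<le> (2 * B) * (22/3 * (real \<tau> * B))"
    by (rule mult_mono[OF c g]) (use bound_nonneg in auto)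
  finally show ?thesis by (simp add: power2_eq_square mult_ac)
qed

text \<open>Integrating the series for the Poisson solution against \<open>?c\<close> gives the
  covariances at all lags from 0 on. Doubling counts lag 0 twice, which the subtracted square
  corrects.\<close>

lemma integral_variance_density: "(\<integral>z. variance_density u z \<partial>\<pi>) = asymp_var M Q \<pi> u"
proof -
  let ?c = "centered \<pi> u" and ?a = "\<lambda>k. kernel_act M Q k (centered \<pi> u)"
  have a: "?a k \<in> borel_measurable M" for k by measurable
  have ca: "\<bar>?c z * ?a k z\<bar> \<le> 4 * B\<^sup>2 * (1/4) ^ (k div \<tau>)" if z: "z \<in> space M" for k z
  proof -
    have "\<bar>?c z\<bar> * \<bar>?a k z\<bar> \<le> (2 * B) * (2 * B * (1/4) ^ (k div \<tau>))"
      by (rule mult_mono[OF abs_centered_le[OF u B z] abs_kernel_act_centered_le[OF u B z]])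
         (use bound_nonneg in auto)
    then show ?thesis by (simp add: abs_mult power2_eq_square mult_ac)
  qed
  have cam: "(\<lambda>z. ?c z * ?a k z) \<in> borel_measurable M" for k by measurable
  note int = integrable_\<pi>[OF cam ca]
  have sum: "summable (\<lambda>k. \<integral>z. norm (?c z * ?a k z) \<partial>\<pi>)"
  proof (rule summable_comparison_test'[OF summable_bound[of "4 * B\<^sup>2"], of 0])
    fix k
    have "(\<integral>z. \<bar>?c z * ?a k z\<bar> \<partial>\<pi>) \<le> (\<integral>z. 4 * B\<^sup>2 * (1/4) ^ (k div \<tau>) \<partial>\<pi>)"
      using int by (intro integral_mono integrable_abs) (auto simp: space_\<pi> intro!: ca)
    then show "norm (\<integral>z. norm (?c z * ?a k z) \<partial>\<pi>) \<le> 4 * B\<^sup>2 * (1/4) ^ (k div \<tau>)"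
      by (simp add: \<pi>.prob_space)
  qed
  have AE: "AE z in \<pi>. summable (\<lambda>k. norm (?c z * ?a k z))"
    by (intro AE_I2) (auto simp: space_\<pi> abs_mult intro!: summable_mult summable_abs_kernel_act)
  have s: "(\<lambda>k. \<integral>z. ?c z * ?a k z \<partial>\<pi>) sums (\<integral>z. (\<Sum>k. ?c z * ?a k z) \<partial>\<pi>)"
    by (rule sums_integral[OF int AE sum])
  have eq: "(\<integral>z. (\<Sum>k. ?c z * ?a k z) \<partial>\<pi>) = (\<integral>z. ?c z * poisson_solution u z \<partial>\<pi>)"
    unfolding poisson_solution_def
    by (intro Bochner_Integration.integral_cong refl suminf_mult summable_kernel_act) (simp add: space_\<pi>)
  have z0: "(\<integral>z. ?c z * ?a 0 z \<partial>\<pi>) = (\<integral>z. (?c z)\<^sup>2 \<partial>\<pi>)"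
    by (intro Bochner_Integration.integral_cong refl) (simp add: space_\<pi> kernel_act_0 power2_eq_square)
  have "(\<Sum>k. \<integral>z. ?c z * ?a (Suc k) z \<partial>\<pi>)
      = (\<integral>z. ?c z * poisson_solution u z \<partial>\<pi>) - (\<integral>z. (?c z)\<^sup>2 \<partial>\<pi>)"
    using suminf_split_head[OF sums_summable[OF s]] sums_unique[OF s] by (simp add: eq z0)
  moreover have "integrable \<pi> (\<lambda>z. ?c z * poisson_solution u z)"
  proof (rule integrable_\<pi>)
    show "\<bar>?c z * poisson_solution u z\<bar> \<le> 2 * B * (8/3 * real \<tau> * B)" if z: "z \<in> space M" for z
      unfolding abs_mult
      by (rule mult_mono[OF abs_centered_le[OF u B z] abs_poisson_solution_le[OF z]])
         (use bound_nonneg in auto)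
  qed measurable
  moreover have "integrable \<pi> (\<lambda>z. (?c z)\<^sup>2)"
  proof (rule integrable_\<pi>)
    show "\<bar>(?c z)\<^sup>2\<bar> \<le> (2 * B)\<^sup>2" if z: "z \<in> space M" for z
      using abs_centered_le[OF u B z] by (metis abs_ge_zero abs_power2 power2_abs power_mono)
  qed measurable
  ultimately show ?thesis
    by (simp add: asymp_var_def variance_density_def mult.assoc)
qed

text \<open>The asymptotic variance is the \<pi>-mean of the conditional variance of
  \<open>?g\<close> after one step, and this is nonnegative by Jensen's inequality.\<close>

lemma asymp_var_nonneg: "0 \<le> asymp_var M Q \<pi> u"
proof -
  let ?g = "poisson_solution u" and ?G = "8/3 * real \<tau> * B"
  have gg: "\<bar>(?g z)\<^sup>2\<bar> \<le> ?G\<^sup>2" if z: "z \<in> space M" for z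
    using abs_poisson_solution_le[OF z] by (metis abs_ge_zero abs_power2 power2_abs power_mono)
  have "0 \<le> (\<integral>z. (\<integral>x. (?g x)\<^sup>2 \<partial>Q z) - (\<integral>x. ?g x \<partial>Q z)\<^sup>2 \<partial>\<pi>)"
  proof (rule Bochner_Integration.integral_nonneg)
    fix z assume "z \<in> space \<pi>"
    then have z: "z \<in> space M" by (simp add: space_\<pi>)
    interpret prob_space "Q z" using z by (rule prob_space_Q)
    have "(\<integral>x. ?g x \<partial>Q z)\<^sup>2 \<le> (\<integral>x. (?g x)\<^sup>2 \<partial>Q z)"
    proof (rule jensens_inequality[where q="\<lambda>x. x\<^sup>2" and I=UNIV])
      show "integrable (Q z) ?g"
        by (rule integrable_Q[OF _ abs_poisson_solution_le z]) measurable
      show "integrable (Q z) (\<lambda>x. (?g x)\<^sup>2)"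
        by (rule integrable_Q[OF _ gg z]) measurable
    qed (auto simp: convex_power2)
    then show "0 \<le> (\<integral>x. (?g x)\<^sup>2 \<partial>Q z) - (\<integral>x. ?g x \<partial>Q z)\<^sup>2" by simp
  qed
  also have "\<dots> = (\<integral>z. (\<integral>x. (?g x)\<^sup>2 \<partial>Q z) - ((?g z)\<^sup>2 - variance_density u z) \<partial>\<pi>)"
    by (intro Bochner_Integration.integral_cong refl)
       (simp add: space_\<pi> poisson_equation variance_density_def power2_eq_square algebra_simps)
  also have "\<dots> = (\<integral>z. (\<integral>x. (?g x)\<^sup>2 \<partial>Q z) \<partial>\<pi>) - (\<integral>z. (?g z)\<^sup>2 - variance_density u z \<partial>\<pi>)"
  proof (rule Bochner_Integration.integral_diff)
    show "integrable \<pi> (\<lambda>z. \<integral>x. (?g x)\<^sup>2 \<partial>Q z)"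
    proof (rule integrable_\<pi>)
      fix z assume z: "z \<in> space M"
      interpret prob_space "Q z" using z by (rule prob_space_Q)
      have "\<bar>\<integral>x. (?g x)\<^sup>2 \<partial>Q z\<bar> \<le> (\<integral>x. \<bar>(?g x)\<^sup>2\<bar> \<partial>Q z)" by (rule integral_abs_bound)
      also have "\<dots> \<le> (\<integral>x. ?G\<^sup>2 \<partial>Q z)"
        using gg by (intro integral_mono integrable_abs integrable_Q[OF _ gg z]) (auto simp: space_Q[OF z])
      finally show "\<bar>\<integral>x. (?g x)\<^sup>2 \<partial>Q z\<bar> \<le> ?G\<^sup>2" by (simp add: prob_space)
    qed measurable
    show "integrable \<pi> (\<lambda>z. (?g z)\<^sup>2 - variance_density u z)"
      by (intro Bochner_Integration.integrable_diff integrable_\<pi>[OF _ gg] integrable_\<pi>[OF _ abs_variance_density_le]) measurable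
  qed
  \<comment> \<open>Invariance of \<pi> replaces the one-step average of \<open>?g\<^sup>2\<close>
    by \<open>?g\<^sup>2\<close>, so that the squares cancel.\<close>
  also have "\<dots> = (\<integral>z. (?g z)\<^sup>2 \<partial>\<pi>) - (\<integral>z. (?g z)\<^sup>2 - variance_density u z \<partial>\<pi>)"
    by (subst integral_\<pi>_Q[OF _ gg]) auto
  also have "\<dots> = (\<integral>z. variance_density u z \<partial>\<pi>)"
    by (subst Bochner_Integration.integral_diff)
       (auto intro!: integrable_\<pi>[OF _ gg] integrable_\<pi>[OF _ abs_variance_density_le])
  finally show ?thesis by (simp add: integral_variance_density)
qed

section \<open>Exponential moments and tail bounds for the chain\<close>

text \<open>The supermartingale is built with \<open>V\<close> equal to
  \<open>exp (x - x\<^sup>2)\<close> at \<open>x = \<theta> * ?g z\<close>; the hypothesis keeps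
  \<open>x\<close> in [-1/5, 1/5]. Removing \<open>V\<close> at the final time costs 6/25 in the
  exponent, bounding it at the initial time 1/5, together 11/25.\<close>

lemma exponential_moment_le:
  assumes \<theta>: "\<bar>\<theta>\<bar> * (8/3 * real \<tau> * B) \<le> 1/5"
  shows "(\<integral>\<^sup>+\<omega>. ennreal (exp (\<Sum>l<n. \<theta> * centered \<pi> u (\<omega> l) - \<theta>\<^sup>2 * variance_density u (\<omega> l)))
      \<partial>chain_law M Q \<pi>) \<le> ennreal (exp (11/25))"
proof -
  let ?c = "centered \<pi> u" and ?g = "poisson_solution u" and ?v = "variance_density u"
  define V where "V z = ennreal (exp (\<theta> * ?g z - (\<theta> * ?g z)\<^sup>2))" for z
  define w where "w z = ennreal (exp (\<theta> * ?c z - \<theta>\<^sup>2 * ?v z))" for z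
  have [measurable]: "V \<in> borel_measurable M" "w \<in> borel_measurable M"
    unfolding V_def w_def by measurable
  have g: "\<bar>\<theta> * ?g z\<bar> \<le> 1/5" if z: "z \<in> space M" for z
  proof -
    have "\<bar>\<theta> * ?g z\<bar> \<le> \<bar>\<theta>\<bar> * (8/3 * real \<tau> * B)"
      unfolding abs_mult by (intro mult_left_mono abs_poisson_solution_le z) auto
    then show ?thesis using \<theta> by linarith
  qed
  have drift: "w z * (\<integral>\<^sup>+x. V x \<partial>Q z) \<le> V z" if z: "z \<in> space M" for z
  proof -
    interpret prob_space "Q z" using z by (rule prob_space_Q)
    have "(\<integral>\<^sup>+x. V x \<partial>Q z) \<le> ennreal (exp ((\<integral>x. \<theta> * ?g x \<partial>Q z) - (\<integral>x. \<theta> * ?g x \<partial>Q z)\<^sup>2))"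
      unfolding V_def
      by (rule expectation_exp_minus_square_le) (use g in \<open>auto simp: space_Q[OF z] sets_Q[OF z] cong: measurable_cong_sets\<close>)
    also have "(\<integral>x. \<theta> * ?g x \<partial>Q z) = \<theta> * (?g z - ?c z)"
      by (simp add: poisson_equation[OF z])
    finally have "w z * (\<integral>\<^sup>+x. V x \<partial>Q z) \<le> w z * ennreal (exp (\<theta> * (?g z - ?c z) - (\<theta> * (?g z - ?c z))\<^sup>2))"
      by (rule mult_left_mono) simp
    \<comment> \<open>The exponents match exactly because
      \<open>(?g - ?c)\<^sup>2 + 2 * ?c * ?g - ?c\<^sup>2 = ?g\<^sup>2\<close>.\<close>
    also have "\<dots> = V z"
      unfolding w_def V_def variance_density_def
      by (simp add: ennreal_mult[symmetric] exp_add[symmetric])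
         (simp add: power2_eq_square algebra_simps)
    finally show ?thesis .
  qed
  have meas: "(\<lambda>\<omega>. (\<Prod>l<n. w (\<omega> l)) * V (\<omega> n)) \<in> borel_measurable (chain_law M Q \<pi>)"
    using sets_chain_law[OF Q \<pi>] by (simp cong: measurable_cong_sets)
  have "(\<integral>\<^sup>+\<omega>. ennreal (exp (\<Sum>l<n. \<theta> * ?c (\<omega> l) - \<theta>\<^sup>2 * ?v (\<omega> l))) \<partial>chain_law M Q \<pi>)
     \<le> (\<integral>\<^sup>+\<omega>. ennreal (exp (6/25)) * ((\<Prod>l<n. w (\<omega> l)) * V (\<omega> n)) \<partial>chain_law M Q \<pi>)"
  proof (rule nn_integral_mono)
    fix \<omega> assume "\<omega> \<in> space (chain_law M Q \<pi>)"
    then have "\<omega> n \<in> space M"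
      using sets_eq_imp_space_eq[OF sets_chain_law[OF Q \<pi>]] by (auto simp: space_PiM)
    then have gn: "\<bar>\<theta> * ?g (\<omega> n)\<bar> \<le> 1/5" by (rule g)
    then have "(\<theta> * ?g (\<omega> n))\<^sup>2 \<le> (1/5)\<^sup>2" by (metis abs_ge_zero power2_abs power_mono)
    \<comment> \<open>The extreme case is \<open>x = -1/5\<close>, where
      \<open>x - x\<^sup>2\<close> is -1/5 - 1/25.\<close>
    then have "- 6/25 \<le> \<theta> * ?g (\<omega> n) - (\<theta> * ?g (\<omega> n))\<^sup>2"
      using gn by (simp add: power2_eq_square abs_le_iff)
    then have "1 \<le> exp (6/25) * exp (\<theta> * ?g (\<omega> n) - (\<theta> * ?g (\<omega> n))\<^sup>2)"
      by (subst exp_add[symmetric]) simp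
    then show "ennreal (exp (\<Sum>l<n. \<theta> * ?c (\<omega> l) - \<theta>\<^sup>2 * ?v (\<omega> l)))
        \<le> ennreal (exp (6/25)) * ((\<Prod>l<n. w (\<omega> l)) * V (\<omega> n))"
      by (simp add: w_def V_def prod_ennreal exp_sum[symmetric] ennreal_mult[symmetric] exp_add[symmetric] 
          del: mult_exp_exp)
  qed
  also have "\<dots> = ennreal (exp (6/25)) * (\<integral>\<^sup>+\<omega>. (\<Prod>l<n. w (\<omega> l)) * V (\<omega> n) \<partial>chain_law M Q \<pi>)"
    by (rule nn_integral_cmult[OF meas])
  also have "\<dots> \<le> ennreal (exp (6/25)) * (\<integral>\<^sup>+z. V z \<partial>\<pi>)"
    by (intro mult_left_mono chain_law_supermartingale[OF Q \<pi> _ _ drift]) auto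
  also have "\<dots> \<le> ennreal (exp (6/25)) * (\<integral>\<^sup>+z. ennreal (exp (1/5)) \<partial>\<pi>)"
  proof (intro mult_left_mono nn_integral_mono)
    fix z assume "z \<in> space \<pi>"
    then have "\<theta> * ?g z - (\<theta> * ?g z)\<^sup>2 \<le> 1/5"
      using g[of z] zero_le_power2[of "\<theta> * ?g z"] unfolding space_\<pi> by linarith
    then show "V z \<le> ennreal (exp (1/5))" by (simp add: V_def)
  qed simp
  also have "\<dots> = ennreal (exp (11/25))"
    by (simp add: \<pi>.emeasure_space_1 ennreal_mult[symmetric] exp_add[symmetric])
  finally show ?thesis .
qed

end

text \<open>A second use of the moment bound, for the variance density with parameter
  \<open>\<theta>\<^sup>2\<close>, replaces the random sum of variances by its stationary mean. The
  exponent is halved because the two bounds are joined by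
  \<open>exp ((S + T) / 2) \<le> (exp S + exp T) / 2\<close>. The coefficient of
  \<open>\<theta> ^ 4\<close> bounds the variance density of the variance density.\<close>

lemma chain_sum_exponential_moment_le:
  assumes u[measurable]: "u \<in> borel_measurable M" and B: "\<And>z. z \<in> space M \<Longrightarrow> \<bar>u z\<bar> \<le> B"
    and \<theta>: "\<bar>\<theta>\<bar> * (real \<tau> * B) \<le> 1/20"
  shows "(\<integral>\<^sup>+\<omega>. ennreal (exp ((\<theta> * chain_sum \<pi> u n \<omega> - real n * \<theta>\<^sup>2 * asymp_var M Q \<pi> u
      - real n * \<theta> ^ 4 * (44/3 * real \<tau> * (44/3 * real \<tau> * B\<^sup>2)\<^sup>2)) / 2)) \<partial>chain_law M Q \<pi>)
    \<le> ennreal (exp (11/25))"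
proof -
  let ?v = "variance_density u" and ?s = "asymp_var M Q \<pi> u"
  let ?B = "44/3 * real \<tau> * B\<^sup>2"
  let ?K = "44/3 * real \<tau> * ?B\<^sup>2"
  define S where "S \<omega> = (\<Sum>l<n. \<theta> * centered \<pi> u (\<omega> l) - \<theta>\<^sup>2 * ?v (\<omega> l))" for \<omega>
  define T where
    "T \<omega> = (\<Sum>l<n. \<theta>\<^sup>2 * centered \<pi> ?v (\<omega> l) - (\<theta>\<^sup>2)\<^sup>2 * variance_density ?v (\<omega> l))" for \<omega>
  have vm[measurable]: "?v \<in> borel_measurable M" by measurable
  note vB = abs_variance_density_le[OF u B]
  have "0 \<le> B" by (rule bound_nonneg[OF u B])
  have S: "(\<integral>\<^sup>+\<omega>. ennreal (exp (S \<omega>)) \<partial>chain_law M Q \<pi>) \<le> ennreal (exp (11/25))"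
    unfolding S_def by (rule exponential_moment_le[OF u B]) (use \<theta> in auto)
  \<comment> \<open>Smallness for the second use: \<open>\<theta>\<^sup>2 * (8/3 * \<tau>) * (44/3 *
    \<tau> * B\<^sup>2)\<close> is at most 352/9 times 1/400, about 0.098 and below 1/5.\<close>
  have "(\<bar>\<theta>\<bar> * (real \<tau> * B))\<^sup>2 \<le> (1/20)\<^sup>2"
    using \<theta> \<open>0 \<le> B\<close> by (intro power_mono) auto
  then have T: "(\<integral>\<^sup>+\<omega>. ennreal (exp (T \<omega>)) \<partial>chain_law M Q \<pi>) \<le> ennreal (exp (11/25))"
    unfolding T_def
    by (intro exponential_moment_le[OF vm vB]) (auto simp: power2_eq_square mult_ac)
  have [measurable_cong]: "sets (chain_law M Q \<pi>) = sets (Pi\<^sub>M UNIV (\<lambda>_. M))"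
    by (rule sets_chain_law[OF Q \<pi>])
  have [measurable]: "S \<in> borel_measurable (chain_law M Q \<pi>)" "T \<in> borel_measurable (chain_law M Q \<pi>)"
    unfolding S_def[abs_def] T_def[abs_def] by measurable
  have half: "ennreal x * ennreal (1/2) + ennreal x * ennreal (1/2) = ennreal x" if "0 \<le> x" for x
    using that by (subst (1 2) ennreal_mult[symmetric], simp_all, subst ennreal_plus[symmetric]) auto
  have "(\<integral>\<^sup>+\<omega>. ennreal (exp ((\<theta> * chain_sum \<pi> u n \<omega> - real n * \<theta>\<^sup>2 * ?s - real n * \<theta> ^ 4 * ?K) / 2))
        \<partial>chain_law M Q \<pi>)
      \<le> (\<integral>\<^sup>+\<omega>. ennreal (exp (S \<omega>)) * ennreal (1/2) + ennreal (exp (T \<omega>)) * ennreal (1/2) \<partial>chain_law M Q \<pi>)"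
  proof (rule nn_integral_mono)
    fix \<omega> assume "\<omega> \<in> space (chain_law M Q \<pi>)"
    then have \<omega>: "\<omega> l \<in> space M" for l
      using sets_eq_imp_space_eq[OF sets_chain_law[OF Q \<pi>]] by (auto simp: space_PiM)
    \<comment> \<open>\<open>?v\<close> enters \<open>S\<close> with factor
      \<open>- \<theta>\<^sup>2\<close> and \<open>T\<close> with \<open>\<theta>\<^sup>2\<close>,
      so only its mean, the asymptotic variance, survives.\<close>
    have "S \<omega> + T \<omega> = (\<Sum>l<n. \<theta> * centered \<pi> u (\<omega> l) - \<theta>\<^sup>2 * ?s - \<theta> ^ 4 * variance_density ?v (\<omega> l))"
      unfolding S_def T_def sum.distrib[symmetric]
      by (intro sum.cong refl)
         (simp add: centered_def[of \<pi> ?v] integral_variance_density[OF u B] algebra_simps)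
    also have "\<dots> \<ge> (\<Sum>l<n. \<theta> * centered \<pi> u (\<omega> l) - \<theta>\<^sup>2 * ?s - \<theta> ^ 4 * ?K)"
      by (intro sum_mono diff_left_mono mult_left_mono abs_le_D1[OF abs_variance_density_le[OF vm vB \<omega>]]
          zero_le_even_power) simp_all
    also have "(\<Sum>l<n. \<theta> * centered \<pi> u (\<omega> l) - \<theta>\<^sup>2 * ?s - \<theta> ^ 4 * ?K)
        = \<theta> * chain_sum \<pi> u n \<omega> - real n * \<theta>\<^sup>2 * ?s - real n * \<theta> ^ 4 * ?K"
      by (simp add: chain_sum_def centered_def sum_subtractf sum_distrib_left right_diff_distrib)
    finally have "exp ((\<theta> * chain_sum \<pi> u n \<omega> - real n * \<theta>\<^sup>2 * ?s - real n * \<theta> ^ 4 * ?K) / 2)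
        \<le> exp ((S \<omega> + T \<omega>) / 2)"
      by simp
    also have "\<dots> \<le> exp (S \<omega>) * (1/2) + exp (T \<omega>) * (1/2)"
    proof -
      have "exp ((S \<omega> + T \<omega>) / 2) = exp (S \<omega> / 2) * exp (T \<omega> / 2)"
        by (simp add: exp_add[symmetric] add_divide_distrib)
      moreover have "exp (S \<omega>) = (exp (S \<omega> / 2))\<^sup>2" "exp (T \<omega>) = (exp (T \<omega> / 2))\<^sup>2"
        by (simp_all add: exp_double[symmetric])
      moreover have "2 * (exp (S \<omega> / 2) * exp (T \<omega> / 2)) \<le> (exp (S \<omega> / 2))\<^sup>2 + (exp (T \<omega> / 2))\<^sup>2"
        using sum_squares_bound[of "exp (S \<omega> / 2)" "exp (T \<omega> / 2)"] by (simp add: mult.assoc)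
      ultimately show ?thesis by simp
    qed
    finally show "ennreal (exp ((\<theta> * chain_sum \<pi> u n \<omega> - real n * \<theta>\<^sup>2 * ?s - real n * \<theta> ^ 4 * ?K) / 2))
        \<le> ennreal (exp (S \<omega>)) * ennreal (1/2) + ennreal (exp (T \<omega>)) * ennreal (1/2)"
      by (subst (1 2) ennreal_mult[symmetric], simp, simp, simp, simp, subst ennreal_plus[symmetric])
         (auto intro!: ennreal_leI simp del: ennreal_plus)
  qed
  also have "\<dots> = (\<integral>\<^sup>+\<omega>. ennreal (exp (S \<omega>)) \<partial>chain_law M Q \<pi>) * ennreal (1/2)
      + (\<integral>\<^sup>+\<omega>. ennreal (exp (T \<omega>)) \<partial>chain_law M Q \<pi>) * ennreal (1/2)"
    by (subst nn_integral_add, simp, simp, subst (1 2) nn_integral_multc) auto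
  also have "\<dots> \<le> ennreal (exp (11/25)) * ennreal (1/2) + ennreal (exp (11/25)) * ennreal (1/2)"
    by (intro add_mono mult_right_mono S T) auto
  also have "\<dots> = ennreal (exp (11/25))" by (rule half) simp
  finally show ?thesis .
qed

lemma chain_sum_measurable:
  assumes [measurable]: "u \<in> borel_measurable M"
  shows "chain_sum \<pi> u n \<in> borel_measurable (chain_law M Q \<pi>)"
proof -
  have "(\<lambda>\<omega>. u (\<omega> l)) \<in> borel_measurable (Pi\<^sub>M UNIV (\<lambda>_. M))" for l
    by measurable
  then have "chain_sum \<pi> u n \<in> borel_measurable (Pi\<^sub>M UNIV (\<lambda>_. M))"
    unfolding chain_sum_def[abs_def]
    by (intro borel_measurable_sum borel_measurable_diff borel_measurable_const)
  then show ?thesis using sets_chain_law[OF Q \<pi>] by (simp cong: measurable_cong_sets)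
qed

text \<open>Markov's inequality; the 2 in front of \<open>t\<close> matches the halved exponent of
  the moment bound.\<close>

lemma chain_sum_tail:
  assumes u: "u \<in> borel_measurable M" and B: "\<And>z. z \<in> space M \<Longrightarrow> \<bar>u z\<bar> \<le> B"
    and \<theta>: "\<bar>\<theta>\<bar> * (real \<tau> * B) \<le> 1/20"
  shows "measure (chain_law M Q \<pi>) {\<omega> \<in> space (chain_law M Q \<pi>).
      2 * t \<le> \<theta> * chain_sum \<pi> u n \<omega> - real n * \<theta>\<^sup>2 * asymp_var M Q \<pi> u
        - real n * \<theta> ^ 4 * (44/3 * real \<tau> * (44/3 * real \<tau> * B\<^sup>2)\<^sup>2)} \<le> exp (11/25 - t)"
proof -
  let ?L = "chain_law M Q \<pi>"
  interpret L: prob_space ?L by (rule prob_space_chain_law[OF Q \<pi>])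
  note [measurable] = chain_sum_measurable[OF u]
  define X where "X \<omega> = \<theta> * chain_sum \<pi> u n \<omega> - real n * \<theta>\<^sup>2 * asymp_var M Q \<pi> u
        - real n * \<theta> ^ 4 * (44/3 * real \<tau> * (44/3 * real \<tau> * B\<^sup>2)\<^sup>2)" for \<omega>
  have [measurable]: "X \<in> borel_measurable ?L" unfolding X_def[abs_def] by measurable
  have "emeasure ?L {\<omega> \<in> space ?L. 2 * t \<le> X \<omega>}
      = emeasure ?L {\<omega> \<in> space ?L. 1 \<le> ennreal (exp (- t)) * ennreal (exp (X \<omega> / 2))}"
    by (intro arg_cong[where f="emeasure ?L"] Collect_cong)
       (auto simp: ennreal_mult[symmetric] exp_add[symmetric] simp del: ennreal_1 simp: ennreal_1[symmetric])
  also have "\<dots> \<le> ennreal (exp (- t)) * (\<integral>\<^sup>+\<omega>. ennreal (exp (X \<omega> / 2)) * indicator (space ?L) \<omega> \<partial>?L)"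
    by (rule nn_integral_Markov_inequality) auto
  also have "\<dots> = ennreal (exp (- t)) * (\<integral>\<^sup>+\<omega>. ennreal (exp (X \<omega> / 2)) \<partial>?L)"
    by (intro arg_cong2[where f="(*)"] refl nn_integral_cong) auto
  also have "\<dots> \<le> ennreal (exp (- t)) * ennreal (exp (11/25))"
    unfolding X_def by (intro mult_left_mono chain_sum_exponential_moment_le[OF assms]) auto
  also have "\<dots> = ennreal (exp (11/25 - t))"
    by (simp add: ennreal_mult[symmetric] exp_add[symmetric])
  finally show ?thesis
    by (simp add: L.emeasure_eq_measure X_def)
qed

text \<open>The tail bound with \<open>t = 2 * p\<close>, taken at \<open>r\<close> and at
  \<open>- r\<close>, covers both signs of the sum. Of the exponent \<open>2 * p\<close>, one half
  is the claimed rate and the other absorbs the factor \<open>2 * exp (11/25)\<close>.\<close>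

lemma chain_sum_concentration:
  fixes u :: "'a \<Rightarrow> real" and p :: real
  assumes u: "u \<in> borel_measurable M" and B: "\<And>z. z \<in> space M \<Longrightarrow> \<bar>u z\<bar> \<le> B"
    and p: "2 \<le> p" and r: "0 < r" "r * (real \<tau> * B) \<le> 1/20"
    and R: "4 * p / r + real n * r * asymp_var M Q \<pi> u
        + real n * r ^ 3 * (44/3 * real \<tau> * (44/3 * real \<tau> * B\<^sup>2)\<^sup>2) \<le> R"
  shows "1 - exp (- p) \<le> measure (chain_law M Q \<pi>)
    {\<omega> \<in> space (chain_law M Q \<pi>). \<bar>chain_sum \<pi> u n \<omega>\<bar> \<le> R}"
proof -
  let ?L = "chain_law M Q \<pi>" and ?K = "44/3 * real \<tau> * (44/3 * real \<tau> * B\<^sup>2)\<^sup>2"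
  let ?s = "asymp_var M Q \<pi> u"
  interpret L: prob_space ?L by (rule prob_space_chain_law[OF Q \<pi>])
  note [measurable] = chain_sum_measurable[OF u]
  define E where "E \<theta> = {\<omega> \<in> space ?L.
      2 * (2 * p) \<le> \<theta> * chain_sum \<pi> u n \<omega> - real n * \<theta>\<^sup>2 * ?s - real n * \<theta> ^ 4 * ?K}" for \<theta>
  have [measurable]: "E \<theta> \<in> sets ?L" for \<theta> unfolding E_def by measurable
  have E: "measure ?L (E \<theta>) \<le> exp (11/25 - 2 * p)" if "\<bar>\<theta>\<bar> = r" for \<theta>
    unfolding E_def by (rule chain_sum_tail[OF u B]) (use r that in auto)
  \<comment> \<open>Multiplied by \<open>r\<close>, the hypothesis on \<open>R\<close> becomes the
    threshold in \<open>E\<close>.\<close>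
  have *: "4 * p + real n * r\<^sup>2 * ?s + real n * r ^ 4 * ?K \<le> r * R"
  proof -
    have "r * (4 * p / r + real n * r * ?s + real n * r ^ 3 * ?K) \<le> r * R"
      using r R by (intro mult_left_mono) auto
    also have "r * (4 * p / r + real n * r * ?s + real n * r ^ 3 * ?K)
        = 4 * p + real n * r\<^sup>2 * ?s + real n * r ^ 4 * ?K"
      using r by (simp add: distrib_left power2_eq_square eval_nat_numeral)
    finally show ?thesis .
  qed
  let ?G = "{\<omega> \<in> space ?L. \<bar>chain_sum \<pi> u n \<omega>\<bar> \<le> R}"
  have sub: "space ?L - ?G \<subseteq> E r \<union> E (- r)"
  proof
    fix \<omega> assume "\<omega> \<in> space ?L - ?G"
    then have \<omega>: "\<omega> \<in> space ?L" "R < \<bar>chain_sum \<pi> u n \<omega>\<bar>" by auto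
    have "r * R \<le> r * \<bar>chain_sum \<pi> u n \<omega>\<bar>" using r \<omega> by (intro mult_left_mono) auto
    then have "r * R \<le> r * chain_sum \<pi> u n \<omega> \<or> r * R \<le> (- r) * chain_sum \<pi> u n \<omega>"
      by (auto simp: abs_if split: if_splits)
    then show "\<omega> \<in> E r \<union> E (- r)"
      using * \<omega>(1) by (auto simp: E_def)
  qed
  have "1 - measure ?L ?G = measure ?L (space ?L - ?G)"
    by (subst L.prob_compl) auto
  also have "\<dots> \<le> measure ?L (E r \<union> E (- r))"
    by (rule L.finite_measure_mono[OF sub]) auto
  also have "\<dots> \<le> measure ?L (E r) + measure ?L (E (- r))"
    by (rule measure_Un_le) auto
  also have "\<dots> \<le> 2 * exp (11/25 - 2 * p)"
    using E[of r] E[of "- r"] r by simp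
  \<comment> \<open>With \<open>p\<close> at least 2, \<open>1 + (p - 11/25)\<close> already exceeds
    2.\<close>
  also have "\<dots> \<le> exp (p - 11/25) * exp (11/25 - 2 * p)"
    using exp_ge_add_one_self[of "p - 11/25"] p by (intro mult_right_mono) auto
  also have "\<dots> = exp (- p)" by (simp add: exp_add[symmetric])
  finally show ?thesis by simp
qed

end

section \<open>Choice of the parameter and comparison of constants\<close>

theorem corollary1:
  fixes M :: "'a measure" and Q :: "'a \<Rightarrow> 'a measure" and \<pi> :: "'a measure"
    and \<tau> n :: nat and f :: "'a \<Rightarrow> real" and \<delta> :: real
  assumes "Q \<in> M \<rightarrow>\<^sub>M prob_algebra M"
    and "UGE M Q \<pi> \<tau>"
    and "f \<in> borel_measurable M"
    and "bounded (f ` space M)"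
    and "n \<ge> 1"
    and "0 < \<delta>" and "\<delta> < 1 / (exp 1)\<^sup>2"
  shows "measure (chain_law M Q \<pi>)
      {\<omega> \<in> space (chain_law M Q \<pi>).
         \<bar>chain_sum \<pi> f n \<omega>\<bar>
           \<le> C\<^sub>1 * sqrt (2 * real n * ln (1 / \<delta>)) * sqrt (asymp_var M Q \<pi> f)
             + 2 * D\<^sub>1 * real n powr (1/4) * real \<tau> powr (3/4) * sup_norm M f * ln_tilde (1 / \<delta>)
             + 2 * D\<^sub>2 * real \<tau> * sup_norm M f * ln_tilde (1 / \<delta>)}
    \<ge> 1 - \<delta>"
proof -
  interpret uniformly_ergodic_kernel M Q \<pi> \<tau>
    using assms(1,2) by unfold_locales
  interpret L: prob_space "chain_law M Q \<pi>" by (rule prob_space_chain_law[OF Q \<pi>])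
  note f = assms(3)
  define F where "F = sup_norm M f"
  define p where "p = ln (1 / \<delta>)"
  define s where "s = asymp_var M Q \<pi> f"
  \<comment> \<open>For positive \<open>A\<close> and \<open>N\<close>, the terms
    \<open>p / r\<close> and \<open>n * r * s\<close> coincide at \<open>r = 1 / A\<close>, and
    \<open>n * r ^ 3 * \<tau> ^ 3 * F ^ 4\<close> equals \<open>N\<close> at
    \<open>r = 1 / N\<close>.\<close>
  define N where "N = real n powr (1/4) * real \<tau> powr (3/4) * F"
  define A where "A = sqrt (real n * s / p)"
  define K where "K = 44/3 * real \<tau> * (44/3 * real \<tau> * F\<^sup>2)\<^sup>2"
  obtain b where b: "\<And>z. z \<in> space M \<Longrightarrow> \<bar>f z\<bar> \<le> b"
    using assms(4) by (auto simp: bounded_iff)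
  have F: "\<bar>f z\<bar> \<le> F" if "z \<in> space M" for z
    unfolding F_def sup_norm_def by (rule cSUP_upper[OF that]) (auto intro!: bdd_aboveI2 b)
  have s: "0 \<le> s" unfolding s_def by (rule asymp_var_nonneg[OF f F])
  have F0: "0 \<le> F" by (rule bound_nonneg[OF f F])
  have \<delta>: "\<delta> = exp (- p)" using assms(6) by (simp add: p_def ln_div)
  have "1 / (exp 1)\<^sup>2 = exp (- 2 :: real)"
    by (simp add: exp_minus exp_double[symmetric] inverse_eq_divide)
  then have "exp (- p) < exp (- 2)" using assms(7) \<delta> by simp
  then have p: "2 < p" by simp
  \<comment> \<open>The argument yields terms linear in \<open>p\<close>; as \<open>p > 2\<close>,
    the factor \<open>log 2 (2 * p)\<close> is at least 2 and absorbs a further factor 2.\<close>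
  have lt: "2 * p \<le> ln_tilde (1 / \<delta>)"
  proof -
    have "log 2 (2 powr 2) \<le> log 2 (2 * p)" using p by (subst log_le_cancel_iff) auto
    then have "2 \<le> log 2 (2 * p)" by (subst (asm) log_powr_cancel) auto
    then have "p * 2 \<le> p * log 2 (2 * p)" using p by (intro mult_left_mono) auto
    then show ?thesis by (simp add: ln_tilde_def p_def mult.commute)
  qed
  have e2: "2 \<le> exp (1::real)" using exp_ge_add_one_self[of 1] by simp
  have C1: "120 \<le> C\<^sub>1" using e2 by (simp add: C\<^sub>1_def)
  have D1: "790 \<le> D\<^sub>1"
  proof -
    have "2 \<le> sqrt (19/3)" by (rule real_le_rsqrt) simp
    then have "16/3 * 2 * 120 \<le> D\<^sub>1"
      unfolding D\<^sub>1_def using C1 by (intro mult_mono) auto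
    then show ?thesis by simp
  qed
  have D2: "640 \<le> D\<^sub>2"
    unfolding D\<^sub>2_def using C1 by (simp add: C\<^sub>2_def)
  have N0: "0 \<le> N" using F0 by (simp add: N_def)
  have A0: "0 \<le> A" using s p by (simp add: A_def)
  have pA: "p * A = sqrt (real n * p) * sqrt s"
  proof -
    have "p * A = sqrt (p\<^sup>2) * A" using p by simp
    also have "\<dots> = sqrt (p\<^sup>2 * (real n * s / p))" unfolding A_def by (rule real_sqrt_mult[symmetric])
    also have "p\<^sup>2 * (real n * s / p) = (real n * p) * s" using p by (simp add: power2_eq_square)
    finally show ?thesis by (simp add: real_sqrt_mult)
  qed
  let ?R = "C\<^sub>1 * sqrt (2 * real n * ln (1 / \<delta>)) * sqrt (asymp_var M Q \<pi> f)
             + 2 * D\<^sub>1 * real n powr (1/4) * real \<tau> powr (3/4) * sup_norm M f * ln_tilde (1 / \<delta>)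
             + 2 * D\<^sub>2 * real \<tau> * sup_norm M f * ln_tilde (1 / \<delta>)"
  \<comment> \<open>These coefficients are what the choice of \<open>r\<close> produces: 5 = 4 + 1,
    3160 = 4 + 3156 with 3156 just above \<open>(44/3) ^ 3\<close>, and 80 = 4 * 20.\<close>
  have R: "5 * (p * A) + 3160 * (p * N) + 80 * (p * (real \<tau> * F)) \<le> ?R"
  proof (intro add_mono)
    have "5 * (p * A) = 5 * sqrt (real n * p) * sqrt s" by (simp add: pA)
    also have "\<dots> \<le> C\<^sub>1 * sqrt (2 * real n * p) * sqrt s"
      using C1 p s by (intro mult_right_mono mult_mono real_sqrt_le_mono) auto
    finally show "5 * (p * A) \<le> C\<^sub>1 * sqrt (2 * real n * ln (1 / \<delta>)) * sqrt (asymp_var M Q \<pi> f)"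
      by (simp add: p_def s_def)
    have "3160 * (p * N) = (2 * 790) * N * (2 * p)" by simp
    also have "\<dots> \<le> (2 * D\<^sub>1) * N * ln_tilde (1 / \<delta>)"
      using D1 N0 p lt by (intro mult_mono) auto
    finally show "3160 * (p * N)
        \<le> 2 * D\<^sub>1 * real n powr (1/4) * real \<tau> powr (3/4) * sup_norm M f * ln_tilde (1 / \<delta>)"
      by (simp add: N_def F_def mult.assoc)
    have "80 * (p * (real \<tau> * F)) = 40 * (real \<tau> * F) * (2 * p)" by simp
    also have "\<dots> \<le> (2 * D\<^sub>2) * (real \<tau> * F) * ln_tilde (1 / \<delta>)"
      using D2 F0 p lt by (intro mult_mono) auto
    finally show "80 * (p * (real \<tau> * F)) \<le> 2 * D\<^sub>2 * real \<tau> * sup_norm M f * ln_tilde (1 / \<delta>)"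
      by (simp add: F_def mult.assoc)
  qed
  show ?thesis
  proof (cases "F = 0")
    \<comment> \<open>Here the denominator in the choice of \<open>r\<close> would vanish, but the
      sum is identically zero and \<open>?R\<close> is nonnegative.\<close>
    case True
    have "0 \<le> ?R"
      using R p A0 N0 F0 by (smt (verit) mult_nonneg_nonneg of_nat_0_le_iff)
    have f0: "f z = 0" if "z \<in> space M" for z using F[OF that] True by simp
    have "(\<integral>x. f x \<partial>\<pi>) = (\<integral>x. 0 \<partial>\<pi>)"
      by (intro Bochner_Integration.integral_cong refl) (simp add: space_\<pi> f0)
    then have "chain_sum \<pi> f n \<omega> = 0" if "\<omega> \<in> space (chain_law M Q \<pi>)" for \<omega>
      using that sets_eq_imp_space_eq[OF sets_chain_law[OF Q \<pi>]]
      by (auto simp: chain_sum_def space_PiM PiE_iff f0 intro!: sum.neutral)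
    then have "{\<omega> \<in> space (chain_law M Q \<pi>). \<bar>chain_sum \<pi> f n \<omega>\<bar> \<le> ?R} = space (chain_law M Q \<pi>)"
      using \<open>0 \<le> ?R\<close> by auto
    then show ?thesis using assms(6) by (simp add: L.prob_space)
  next
    case False
    then have Fp: "0 < F" using F0 by simp
    \<comment> \<open>up to a factor three, the minimum of the three values that are optimal for the three terms\<close>
    define r where "r = 1 / (A + N + 20 * (real \<tau> * F))"
    have \<tau>F: "0 < real \<tau> * F" using Fp \<tau> by simp
    then have den: "0 < A + N + 20 * (real \<tau> * F)" using A0 N0 by linarith
    have r: "0 < r" using den by (simp add: r_def)
    \<comment> \<open>The weight 20 in the denominator is what gives the admissibility condition
      \<open>rF\<close>.\<close>
    have rA: "r * A \<le> 1" and rN: "r * N \<le> 1" and rF: "r * (real \<tau> * F) \<le> 1/20"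
      using den A0 N0 \<tau>F by (auto simp: r_def field_simps)
    have N4: "N ^ 4 = real n * real \<tau> ^ 3 * F ^ 4"
      using assms(5) \<tau> by (simp add: N_def power_mult_distrib powr_power)
    have "4 * p / r = 4 * (p * A) + 4 * (p * N) + 80 * (p * (real \<tau> * F))"
      by (simp add: r_def algebra_simps)
    moreover have "real n * r * s \<le> p * A"
    proof -
      have "A\<^sup>2 = real n * s / p" using s p by (simp add: A_def)
      then have "real n * r * s = (p * A) * (r * A)"
        using p by (simp add: power2_eq_square field_simps)
      also have "\<dots> \<le> (p * A) * 1" using rA p A0 by (intro mult_left_mono) auto
      finally show ?thesis by simp
    qed
    moreover have "real n * r ^ 3 * K \<le> 3156 * (p * N)"
    proof -
      \<comment> \<open>\<open>K\<close> equals \<open>(44/3) ^ 3 * \<tau> ^ 3 * F ^ 4\<close>, so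
        \<open>N4\<close> turns the term into a multiple of \<open>N * (r * N) ^ 3\<close>.\<close>
      have "real n * r ^ 3 * K = (44/3) ^ 3 * r ^ 3 * (real n * real \<tau> ^ 3 * F ^ 4)"
        by (simp add: K_def power_mult_distrib eval_nat_numeral)
      also have "\<dots> = (44/3) ^ 3 * N * (r * N) ^ 3"
        unfolding N4[symmetric] by (simp add: power_mult_distrib eval_nat_numeral)
      also have "\<dots> \<le> (44/3) ^ 3 * N * 1"
        using rN N0 r by (intro mult_left_mono power_le_one) auto
      also have "\<dots> \<le> 3156 * (1 * N)" using N0 by (simp add: eval_nat_numeral)
      also have "\<dots> \<le> 3156 * (p * N)" using N0 p by (intro mult_left_mono mult_right_mono) auto
      finally show ?thesis .
    qed
    ultimately have "4 * p / r + real n * r * s + real n * r ^ 3 * K \<le> ?R"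
      using R by linarith
    from chain_sum_concentration[OF f F _ r rF this[unfolded K_def s_def]] p
    show ?thesis by (simp add: \<delta>[symmetric])
  qed
qed

end
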